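(* Let $\lambda<\kappa$ be infinite regular cardinals. If $\square(\kappa)$ holds, then there is a $\kappa$-Aronszajn tree with a $\lambda$-ascent path.
   Context: For a set $A$ of ordinals, $\mathrm{acc}(A)$ is the set of $\alpha\in A$ with $\alpha>0$ and $\sup(A\cap\alpha)=\alpha$; so $\mathrm{acc}(\kappa)$ is the set of nonzero limit ordinals below $\kappa$. $\square(\kappa)$ (for $\kappa$ uncountable regular): there is a $\square(\kappa)$-sequence, i.e. a sequence $\langle C_\alpha\mid\alpha<\kappa\rangle$ such that (1) for all $\alpha\in\mathrm{acc}(\kappa)$, $C_\alpha$ is a club subset of $\alpha$; (2) if $\alpha,\beta\in\mathrm{acc}(\kappa)$ and $\alpha\in\mathrm{acc}(C_\beta)$, then $C_\alpha=C_\beta\cap\alpha$; (3) there is no club $D$ in $\kappa$ such that $D\cap\alpha=C_\alpha$ for all $\alpha\in\mathrm{acc}(D)$. (Entries at non-limit indices are irrelevant.) A tree is a partial order $\mathbb{T}$ such that for each $t\in\mathbb{T}$ the set $\{s\mid s<_{\mathbb{T}}t\}$ is well-ordered by $<_{\mathbb{T}}$; the order type of this set is the height of $t$. $\mathbb{T}(\alpha)$ is the set of nodes of height $\alpha$, and the height of $\mathbb{T}$ is the least $\alpha$ with $\mathbb{T}(\alpha)=\emptyset$. A branch is a subset linearly ordered by $\leq_{\mathbb{T}}$; it is cofinal if the heights of its elements are cofinal in the height of $\mathbb{T}$. A $\kappa$-tree is a tree of height $\kappa$ with $|\mathbb{T}(\alpha)|<\kappa$ for all $\alpha<\kappa$.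 A $\kappa$-Aronszajn tree is a $\kappa$-tree without cofinal branches. A $\lambda$-ascent path through a tree $\mathbb{T}$ of height $\kappa$ is a sequence $\langle b_\alpha:\lambda\to\mathbb{T}(\alpha)\mid\alpha<\kappa\rangle$ of functions such that for all $\alpha<\beta<\kappa$ there is $i<\lambda$ with $b_\alpha(j)<_{\mathbb{T}}b_\beta(j)$ for all $i\leq j<\lambda$. *)

theory Defs
  imports Main
begin

unbundle cardinal_syntax

text \<open>
  A cardinal \<open>\<kappa>\<close> is a relation \<open>r\<close> with \<open>Card_order r\<close>. The ordinals below \<open>\<kappa>\<close> are the elements of
  \<open>Field r\<close>, and \<open>\<alpha> < \<beta>\<close> is \<open>\<alpha> \<in> underS r \<beta>\<close>. As with von Neumann ordinals, the ordinal \<open>\<alpha>\<close> as a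
  set is \<open>underS r \<alpha>\<close>, and \<open>\<kappa>\<close> itself is \<open>Field r\<close>; sets of ordinals are subsets of \<open>Field r\<close>.
\<close>

text \<open>The supremum in \<open>r\<close> of the empty set is the least element, so \<open>\<alpha> > 0\<close> is a separate condition.\<close>

definition acc :: "'a rel \<Rightarrow> 'a set \<Rightarrow> 'a set" where
  "acc r A = {\<alpha> \<in> A. underS r \<alpha> \<noteq> {} \<and> wo_rel.supr r (A \<inter> underS r \<alpha>) = \<alpha>}"

text \<open>
  \<open>club r S C\<close>: \<open>C\<close> is closed and unbounded in the ordinal \<open>S\<close>, where \<open>S\<close> is \<open>underS r \<alpha>\<close> or \<open>Field r\<close>.
\<close>

definition club :: "'a rel \<Rightarrow> 'a set \<Rightarrow> 'a set \<Rightarrow> bool" where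
  "club r S C \<longleftrightarrow>
     C \<subseteq> S \<and>
     (\<forall>\<beta>\<in>S. \<exists>\<gamma>\<in>C. (\<beta>, \<gamma>) \<in> r) \<and>
     (\<forall>\<beta>\<in>S. underS r \<beta> \<noteq> {} \<and> wo_rel.supr r (C \<inter> underS r \<beta>) = \<beta> \<longrightarrow> \<beta> \<in> C)"

definition square_seq :: "'a rel \<Rightarrow> ('a \<Rightarrow> 'a set) \<Rightarrow> bool" where
  "square_seq r C \<longleftrightarrow>
     (\<forall>\<alpha>\<in>acc r (Field r). club r (underS r \<alpha>) (C \<alpha>)) \<and>
     (\<forall>\<alpha>\<in>acc r (Field r). \<forall>\<beta>\<in>acc r (Field r). \<alpha> \<in> acc r (C \<beta>) \<longrightarrow> C \<alpha> = C \<beta> \<inter> underS r \<alpha>) \<and>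
     \<not> (\<exists>D. club r (Field r) D \<and> (\<forall>\<alpha>\<in>acc r D. D \<inter> underS r \<alpha> = C \<alpha>))"

definition square :: "'a rel \<Rightarrow> bool" where
  "square r \<longleftrightarrow> (\<exists>C. square_seq r C)"

text \<open>
  A tree is given by its reflexive order \<open>T\<close>; its nodes are the elements of \<open>Field T\<close>, and
  \<open>underS T t\<close> is the set of strict predecessors of \<open>t\<close>.
\<close>

definition tree :: "'t rel \<Rightarrow> bool" where
  "tree T \<longleftrightarrow> Partial_order T \<and>
     (\<forall>t\<in>Field T. well_order_on (underS T t) (Restr T (underS T t)))"

text \<open>
  \<open>nodes_of_height T \<rho>\<close> is the level of \<open>T\<close> at the order type of the well-order \<open>\<rho>\<close>;
  \<open>level r T \<alpha>\<close> is the level at the ordinal \<open>\<alpha>\<close> below \<open>r\<close>.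
\<close>

definition nodes_of_height :: "'t rel \<Rightarrow> 'a rel \<Rightarrow> 't set" where
  "nodes_of_height T \<rho> = {t \<in> Field T. Restr T (underS T t) =o \<rho>}"

definition level :: "'a rel \<Rightarrow> 't rel \<Rightarrow> 'a \<Rightarrow> 't set" where
  "level r T \<alpha> = nodes_of_height T (Restr r (underS r \<alpha>))"

definition has_height :: "'t rel \<Rightarrow> 'a rel \<Rightarrow> bool" where
  "has_height T r \<longleftrightarrow> nodes_of_height T r = {} \<and> (\<forall>\<alpha>\<in>Field r. level r T \<alpha> \<noteq> {})"

text \<open>Branches are the elements of \<open>Chains T\<close>; these are automatically subsets of \<open>Field T\<close>.\<close>

definition cofinal_branch :: "'a rel \<Rightarrow> 't rel \<Rightarrow> 't set \<Rightarrow> bool" where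
  "cofinal_branch r T B \<longleftrightarrow> B \<in> Chains T \<and>
     (\<forall>\<alpha>\<in>Field r. \<exists>\<beta>\<in>Field r. (\<alpha>, \<beta>) \<in> r \<and> B \<inter> level r T \<beta> \<noteq> {})"

definition kappa_tree :: "'a rel \<Rightarrow> 't rel \<Rightarrow> bool" where
  "kappa_tree r T \<longleftrightarrow> tree T \<and> has_height T r \<and> (\<forall>\<alpha>\<in>Field r. |level r T \<alpha>| <o r)"

definition aronszajn_tree :: "'a rel \<Rightarrow> 't rel \<Rightarrow> bool" where
  "aronszajn_tree r T \<longleftrightarrow> kappa_tree r T \<and> \<not> (\<exists>B. cofinal_branch r T B)"

text \<open>\<open>ascent_path l r T b\<close>: the cardinal \<open>l\<close> is the width of the path and \<open>r\<close> is the height of \<open>T\<close>.\<close>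

definition ascent_path :: "'b rel \<Rightarrow> 'a rel \<Rightarrow> 't rel \<Rightarrow> ('a \<Rightarrow> 'b \<Rightarrow> 't) \<Rightarrow> bool" where
  "ascent_path l r T b \<longleftrightarrow>
     (\<forall>\<alpha>\<in>Field r. \<forall>j\<in>Field l. b \<alpha> j \<in> level r T \<alpha>) \<and>
     (\<forall>\<beta>\<in>Field r. \<forall>\<alpha>\<in>underS r \<beta>. \<exists>i\<in>Field l. \<forall>j\<in>Field l.
        (i, j) \<in> l \<longrightarrow> b \<alpha> j \<in> underS T (b \<beta> j))"

end

theory Submission
  imports Defs
begin

text \<open>
  The idea is to colour the pairs \<open>\<alpha> < \<beta> < \<kappa>\<close> with ordinals below \<open>\<lambda>\<close> by a function \<open>\<rho>\<close> that is
  subadditive in the sense that, for \<open>\<alpha> < \<beta> < \<gamma>\<close>,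
  \<open>\<rho>(\<alpha>, \<gamma>) \<le> max (\<rho>(\<alpha>, \<beta>)) (\<rho>(\<beta>, \<gamma>))\<close> and \<open>\<rho>(\<alpha>, \<beta>) \<le> max (\<rho>(\<alpha>, \<gamma>)) (\<rho>(\<beta>, \<gamma>))\<close>.
  Once \<open>i \<ge> \<rho>(\<alpha>, \<beta>)\<close>, the functions \<open>max i (\<rho>(\<cdot>, \<alpha>))\<close> and \<open>max i (\<rho>(\<cdot>, \<beta>))\<close> agree below \<open>\<alpha>\<close>. Take as
  nodes of height \<open>\<alpha>\<close> the restrictions to \<open>\<alpha>\<close> of all functions \<open>max i (\<rho>(\<cdot>, \<beta>))\<close> with \<open>i < \<lambda>\<close> and
  \<open>\<alpha> \<le> \<beta>\<close>, ordered by extension. Then \<open>b\<^sub>\<alpha>(i) = max i (\<rho>(\<cdot>, \<alpha>))\<close> is a \<open>\<lambda>\<close>-ascent path.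
  Two more properties of \<open>\<rho>\<close> make the tree Aronszajn.

  \<^item> No cofinal branch. The union of a cofinal branch is a function \<open>\<kappa> \<rightarrow> \<lambda>\<close>, which by regularity
    is bounded by some \<open>j < \<lambda>\<close> on an unbounded set \<open>X\<close>; subadditivity gives \<open>\<rho> \<le> j\<close> on all pairs from
    \<open>X\<close>. So it suffices that no unbounded set has this property (\<open>no_unbounded_linked\<close>).
  \<^item> Small levels. The colour \<open>\<rho>(\<xi>, \<beta>)\<close> is computed along the walk from \<open>\<beta>\<close> down to \<open>\<xi>\<close>, whose part
    above \<open>\<alpha>\<close> influences the restriction to \<open>\<alpha>\<close> only through finitely many traces \<open>C\<^sub>\<gamma> \<inter> \<alpha>\<close> and labels. By
    coherence there are fewer than \<open>\<kappa>\<close> such traces (\<open>small_traces\<close>, \<open>small_levels\<close>).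

  The colouring is a variant of the one that Todorcevic attaches to a square sequence. Given a
  coherent sequence of clubs \<open>C\<^sub>\<beta>\<close> and labels \<open>h(\<beta>) < \<lambda>\<close> with \<open>h(\<alpha>) = h(\<beta>)\<close> for \<open>\<alpha> \<in> acc(C\<^sub>\<beta>)\<close>, put
  \<open>\<rho>(\<alpha>, \<beta>) = max {h(\<beta>), \<rho>(\<alpha>, min(C\<^sub>\<beta> - \<alpha>)), \<rho>(\<xi>, \<alpha>) | \<xi> \<in> N}\<close> with \<open>\<rho>(\<alpha>, \<alpha>) = 0\<close>, where \<open>N\<close> is the finite
  set of the points of \<open>C\<^sub>\<beta> \<inter> \<alpha>\<close> that lie at or above the last limit point of \<open>C\<^sub>\<beta>\<close> up to \<open>\<alpha>\<close>. Subadditivity is one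
  simultaneous induction (\<open>linked_subadditive\<close>), and the sets \<open>{\<alpha> < \<beta> | \<rho>(\<alpha>, \<beta>) \<le> j}\<close> are closed
  below \<open>\<beta>\<close> (\<open>linked_closed\<close>). Hence if \<open>\<rho> \<le> j\<close> on the pairs from an unbounded set, then \<open>h(\<delta>) \<le> j\<close> at
  all limit points \<open>\<delta>\<close> of that set. This is impossible as soon as \<open>{\<delta> | h(\<delta>) > j}\<close> is stationary for each
  \<open>j < \<lambda>\<close>.

  Such labels are where the absence of a thread enters. For a suitable \<open>\<epsilon> < \<kappa>\<close> there are
  unboundedly many \<open>\<eta>\<close> such that \<open>min(C\<^sub>\<alpha> - \<epsilon>) = \<eta>\<close> for stationarily many \<open>\<alpha>\<close>
  (\<open>unbounded_stationary_fibres\<close>); replace \<open>C\<^sub>\<alpha>\<close> by \<open>C\<^sub>\<alpha> - \<epsilon>\<close> and label \<open>\<alpha>\<close> according to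
  the minimum of this set. If there were no such \<open>\<epsilon>\<close>, then for club many \<open>\<alpha>\<close> the set \<open>C\<^sub>\<alpha>\<close> would meet so many
  intervals that it accumulates at all earlier limit points of that club, and the sets \<open>C\<^sub>\<alpha>\<close> would
  cohere to a thread.
\<close>

section \<open>Regular uncountable cardinals as initial segments of a well-ordered type\<close>

text \<open>
  Placing the elements outside \<open>Field r\<close> on top turns \<open>Field r\<close> into an initial segment of a
  well-order of the whole type. The order reasoning of the class \<open>wellorder\<close> then applies without carrier
  conditions, and an ordinal belongs to \<open>Field r\<close> as soon as some larger one does.
\<close>

lemma wellorder_extending_Well_order:
  fixes r :: "'a rel"
  assumes "Well_order r"
  obtains le lt :: "'a \<Rightarrow> 'a \<Rightarrow> bool"
  where "class.wellorder le lt" and "\<And>x y. y \<in> Field r \<Longrightarrow> le x y \<longleftrightarrow> (x, y) \<in> r"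
proof -
  obtain w :: "'a rel" where w: "Well_order w" "Field w = UNIV"
    using well_ordering[where 'a = 'a] by (elim exE conjE)
  interpret R: wo_rel r using assms by (simp add: wo_rel_def)
  interpret W: wo_rel w using w by (simp add: wo_rel_def)
  define le where "le = (\<lambda>x y. if y \<in> Field r then (x, y) \<in> r else x \<in> Field r \<or> (x, y) \<in> w)"
  define lt where "lt = (\<lambda>x y. le x y \<and> \<not> le y x)"
  have rF: "x \<in> Field r" "y \<in> Field r" if "(x, y) \<in> r" for x y
    using that by (auto simp: Field_def)
  have refl: "le x x" for x
    using R.REFL W.REFL w(2) by (auto simp: le_def refl_on_def)
  have trans: "le x z" if "le x y" "le y z" for x y z
    using that rF R.TRANS W.TRANS unfolding le_def trans_def by (smt (verit))
  have antisym: "x = y" if "le x y" "le y x" for x y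
    using that rF R.ANTISYM W.ANTISYM unfolding le_def antisym_def by (smt (verit))
  have total: "le x y \<or> le y x" for x y
    using R.TOTALS W.TOTALS w(2) unfolding le_def by auto
  have wfr: "wf (r - Id)" "wf (w - Id)"
    using R.WF W.WF by auto
  have ind: "P a" if step: "\<And>x. (\<And>y. lt y x \<Longrightarrow> P y) \<Longrightarrow> P x" for P a
  proof -
    have in_r: "x \<in> Field r \<longrightarrow> P x" for x
    proof (induction x rule: wf_induct_rule[OF wfr(1)])
      case (1 x)
      show ?case
      proof
        assume "x \<in> Field r"
        then have "(y, x) \<in> r - Id \<and> y \<in> Field r" if "lt y x" for y
          using that refl rF unfolding lt_def le_def by auto
        with 1 show "P x" by (blast intro: step)
      qed
    qed
    show "P a"
    proof (induction a rule: wf_induct_rule[OF wfr(2)])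
      case (1 x)
      show ?case
      proof (cases "x \<in> Field r")
        case False
        then have "(y, x) \<in> w - Id \<or> y \<in> Field r" if "lt y x" for y
          using that refl unfolding lt_def le_def by auto
        with 1 in_r show ?thesis by (blast intro: step)
      qed (use in_r in blast)
    qed
  qed
  have "class.wellorder le lt"
  proof unfold_locales
    show "P a" if "\<And>x. (\<And>y. lt y x \<Longrightarrow> P y) \<Longrightarrow> P x" for P a
      by (rule ind) (rule that)
  qed (use refl trans antisym total in \<open>auto simp: lt_def\<close>)
  then show thesis
    by (rule that) (auto simp: le_def)
qed

locale regular_uncountable = wellorder less_eq less
  for less_eq :: "'a \<Rightarrow> 'a \<Rightarrow> bool" (infix "\<sqsubseteq>" 50) and less :: "'a \<Rightarrow> 'a \<Rightarrow> bool" (infix "\<sqsubset>" 50) +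
  fixes \<kappa> :: "'a rel"
  assumes Cinfinite: "Cinfinite \<kappa>" and regular: "regularCard \<kappa>" and uncountable: "natLeq <o \<kappa>"
    and initial_segment: "y \<in> Field \<kappa> \<Longrightarrow> x \<sqsubseteq> y \<longleftrightarrow> (x, y) \<in> \<kappa>"
begin

abbreviation least :: "('a \<Rightarrow> bool) \<Rightarrow> 'a" where
  "least \<equiv> ord.Least (\<sqsubseteq>)"

text \<open>
  The ordinal \<open>\<delta>\<close> need not belong to \<open>A\<close>; \<open>limit_point UNIV \<delta>\<close> says that \<open>\<delta>\<close> is a nonzero limit ordinal.
\<close>

definition limit_point :: "'a set \<Rightarrow> 'a \<Rightarrow> bool" where
  "limit_point A \<delta> \<longleftrightarrow> (\<exists>\<xi>. \<xi> \<sqsubset> \<delta>) \<and> (\<forall>\<xi>. \<xi> \<sqsubset> \<delta> \<longrightarrow> (\<exists>a\<in>A. \<xi> \<sqsubset> a \<and> a \<sqsubset> \<delta>))"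

definition unbounded :: "'a set \<Rightarrow> bool" where
  "unbounded X \<longleftrightarrow> X \<subseteq> Field \<kappa> \<and> (\<forall>\<xi>\<in>Field \<kappa>. \<exists>x\<in>X. \<xi> \<sqsubset> x)"

text \<open>
  Quantifying over the limit points of unbounded sets is the same as quantifying over clubs, because
  the limit points of an unbounded set form a club and each club contains its limit points.
\<close>

definition stationary :: "'a set \<Rightarrow> bool" where
  "stationary S \<longleftrightarrow> (\<forall>X. unbounded X \<longrightarrow> (\<exists>\<delta>\<in>S \<inter> Field \<kappa>. limit_point X \<delta>))"

lemma Field_down: "y \<in> Field \<kappa> \<Longrightarrow> x \<sqsubseteq> y \<Longrightarrow> x \<in> Field \<kappa>"
  using initial_segment by (auto simp: Field_def)

lemma Field_down': "y \<in> Field \<kappa> \<Longrightarrow> x \<sqsubset> y \<Longrightarrow> x \<in> Field \<kappa>"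
  using Field_down less_imp_le by blast

lemma underS_eq: "y \<in> Field \<kappa> \<Longrightarrow> underS \<kappa> y = {x. x \<sqsubset> y}"
  using initial_segment by (auto simp: underS_def less_le)

lemma Card_order: "Card_order \<kappa>" and infinite_Field: "\<not> finite (Field \<kappa>)"
  using Cinfinite by (auto simp: cinfinite_def)

lemma small_below: "y \<in> Field \<kappa> \<Longrightarrow> |{x. x \<sqsubset> y}| <o \<kappa>"
  using card_of_underS[OF Card_order] underS_eq by metis

lemma small_subset: "|B| <o \<kappa> \<Longrightarrow> A \<subseteq> B \<Longrightarrow> |A| <o \<kappa>"
  using card_of_mono1 ordLeq_ordLess_trans by blast

lemma small_image: "|A| <o \<kappa> \<Longrightarrow> |f ` A| <o \<kappa>"
  using card_of_image ordLeq_ordLess_trans by blast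

lemma small_Union: "|I| <o \<kappa> \<Longrightarrow> (\<And>i. i \<in> I \<Longrightarrow> |A i| <o \<kappa>) \<Longrightarrow> |\<Union>i\<in>I. A i| <o \<kappa>"
  using regularCard_UNION_bound[OF Cinfinite regular] by blast

lemma small_Times: "|A| <o \<kappa> \<Longrightarrow> |B| <o \<kappa> \<Longrightarrow> |A \<times> B| <o \<kappa>"
proof -
  assume A: "|A| <o \<kappa>" and B: "|B| <o \<kappa>"
  have "|\<Union>a\<in>A. (\<lambda>b. (a, b)) ` B| <o \<kappa>"
    by (intro small_Union small_image A B)
  then show ?thesis
    by (rule small_subset) auto
qed

lemma small_finite: "finite A \<Longrightarrow> |A| <o \<kappa>"
  using finite_ordLess_infinite[OF card_of_Well_order] Card_order infinite_Field
  by (metis Field_card_of card_order_on_well_order_on)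

lemma small_Un: "|A| <o \<kappa> \<Longrightarrow> |B| <o \<kappa> \<Longrightarrow> |A \<union> B| <o \<kappa>"
  using card_of_Un_ordLess_infinite_Field[OF infinite_Field Card_order] by blast

lemma small_nat: "|A :: nat set| <o \<kappa>"
  using uncountable card_of_nat card_of_mono1[of A UNIV]
  by (meson ordLeq_ordIso_trans ordLeq_ordLess_trans subset_UNIV)

lemma small_lists:
  assumes "|P| <o \<kappa>"
  shows "|lists P| <o \<kappa>"
proof -
  have "|{l \<in> lists P. length l = n}| <o \<kappa>" for n
  proof (induction n)
    case 0
    show ?case by (rule small_finite) (auto intro: finite_subset[of _ "{[]}"])
  next
    case (Suc n)
    have "{l \<in> lists P. length l = Suc n} \<subseteq> (\<lambda>(p, l). p # l) ` (P \<times> {l \<in> lists P. length l = n})"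
      by (auto simp: length_Suc_conv image_iff)
    then show ?case
      by (rule small_subset[OF small_image[OF small_Times[OF assms Suc]]])
  qed
  then have "|\<Union>n. {l \<in> lists P. length l = n}| <o \<kappa>"
    by (intro small_Union[OF small_nat])
  moreover have "lists P = (\<Union>n. {l \<in> lists P. length l = n})"
    by auto
  ultimately show ?thesis
    by simp
qed

lemma small_bounded:
  assumes "A \<subseteq> Field \<kappa>" "|A| <o \<kappa>"
  shows "\<exists>b\<in>Field \<kappa>. \<forall>a\<in>A. a \<sqsubset> b"
proof -
  have step: "\<exists>b\<in>Field \<kappa>. \<forall>a\<in>B. a \<sqsubseteq> b" if "B \<subseteq> Field \<kappa>" "|B| <o \<kappa>" for B
  proof -
    have "\<not> cofinal B \<kappa>"
      using that regular not_ordLess_ordIso unfolding regularCard_def by blast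
    then obtain b where "b \<in> Field \<kappa>" "\<forall>a\<in>B. a = b \<or> (b, a) \<notin> \<kappa>"
      unfolding cofinal_def by metis
    then show ?thesis
      using that initial_segment by (metis linear subsetD)
  qed
  obtain b where b: "b \<in> Field \<kappa>" "\<forall>a\<in>A. a \<sqsubseteq> b"
    using step[OF assms] by blast
  have "\<exists>c\<in>Field \<kappa>. b \<sqsubset> c"
  proof (rule ccontr)
    assume "\<not> ?thesis"
    then have "Field \<kappa> \<subseteq> {x. x \<sqsubset> b} \<union> {b}"
      by force
    moreover have "|{x. x \<sqsubset> b} \<union> {b}| <o \<kappa>"
      by (intro small_Un small_below b small_finite) auto
    ultimately have "|Field \<kappa>| <o \<kappa>"
      using small_subset by blast
    then show False
      using card_of_Field_ordIso[OF Card_order] not_ordLess_ordIso by blast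
  qed
  with b show ?thesis
    using le_less_trans by blast
qed

lemma no_maximum: "x \<in> Field \<kappa> \<Longrightarrow> \<exists>y\<in>Field \<kappa>. x \<sqsubset> y"
  using small_bounded[of "{x}"] small_finite[of "{x}"] by auto

lemma small_atMost: "y \<in> Field \<kappa> \<Longrightarrow> |{x. x \<sqsubseteq> y}| <o \<kappa>"
  using small_Un[OF small_below small_finite[of "{y}"]]
  by (rule small_subset) (auto simp: le_less)

text \<open>
  The least ordinal above an \<open>\<omega>\<close>-sequence that absorbs \<open>\<Phi>\<close> step by step is closed under \<open>\<Phi>\<close>; it
  stays below \<open>\<kappa>\<close> since \<open>\<kappa>\<close> has uncountable cofinality.
\<close>

lemma closed_under_unbounded:
  assumes small: "\<And>x. x \<in> Field \<kappa> \<Longrightarrow> \<Phi> x \<subseteq> Field \<kappa> \<and> |\<Phi> x| <o \<kappa>" and \<xi>: "\<xi> \<in> Field \<kappa>"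
  obtains \<alpha> where "\<alpha> \<in> Field \<kappa>" "\<xi> \<sqsubset> \<alpha>" "limit_point UNIV \<alpha>" "\<And>x y. x \<sqsubset> \<alpha> \<Longrightarrow> y \<in> \<Phi> x \<Longrightarrow> y \<sqsubset> \<alpha>"
proof -
  have "\<exists>b\<in>Field \<kappa>. x \<sqsubset> b \<and> (\<forall>z y. z \<sqsubseteq> x \<longrightarrow> y \<in> \<Phi> z \<longrightarrow> y \<sqsubset> b)" if x: "x \<in> Field \<kappa>" for x
  proof -
    have "|{x} \<union> (\<Union>z\<in>{z. z \<sqsubseteq> x}. \<Phi> z)| <o \<kappa>"
      using small Field_down[OF x]
      by (intro small_Un small_Union small_atMost[OF x]) (auto intro: small_finite)
    moreover have "{x} \<union> (\<Union>z\<in>{z. z \<sqsubseteq> x}. \<Phi> z) \<subseteq> Field \<kappa>"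
      using x small Field_down by blast
    ultimately obtain b where "b \<in> Field \<kappa>" "\<forall>a\<in>{x} \<union> (\<Union>z\<in>{z. z \<sqsubseteq> x}. \<Phi> z). a \<sqsubset> b"
      using small_bounded by metis
    then show ?thesis
      by (intro bexI[of _ b]) auto
  qed
  then obtain nx where nx: "\<And>x. x \<in> Field \<kappa> \<Longrightarrow> nx x \<in> Field \<kappa> \<and> x \<sqsubset> nx x"
    "\<And>x z y. x \<in> Field \<kappa> \<Longrightarrow> z \<sqsubseteq> x \<Longrightarrow> y \<in> \<Phi> z \<Longrightarrow> y \<sqsubset> nx x"
    by metis
  define s where "s = rec_nat \<xi> (\<lambda>_. nx)"
  have s: "s 0 = \<xi>" "s (Suc n) = nx (s n)" for n
    by (simp_all add: s_def)
  have sF: "s n \<in> Field \<kappa>" for n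
    by (induction n) (use s \<xi> nx in auto)
  have "range s \<subseteq> Field \<kappa>" "|range s| <o \<kappa>"
    using sF small_image small_nat by auto
  then obtain b where b: "b \<in> Field \<kappa>" "\<forall>n. s n \<sqsubset> b"
    using small_bounded[of "range s"] by auto
  define \<alpha> where "\<alpha> = least (\<lambda>a. \<forall>n. s n \<sqsubset> a)"
  have a: "s n \<sqsubset> \<alpha>" for n
    using LeastI[of "\<lambda>a. \<forall>n. s n \<sqsubset> a", OF b(2)] by (simp add: \<alpha>_def)
  have "\<alpha> \<sqsubseteq> b"
    unfolding \<alpha>_def by (rule Least_le) (use b in blast)
  have below: "\<exists>n. x \<sqsubseteq> s n" if "x \<sqsubset> \<alpha>" for x
    using not_less_Least[of x "\<lambda>a. \<forall>n. s n \<sqsubset> a"] that by (auto simp: \<alpha>_def not_less)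
  show thesis
  proof
    show "\<alpha> \<in> Field \<kappa>"
      using b \<open>\<alpha> \<sqsubseteq> b\<close> Field_down by blast
    show "\<xi> \<sqsubset> \<alpha>"
      using a[of 0] s by simp
    show "limit_point UNIV \<alpha>"
      unfolding limit_point_def using a below nx(1)[OF sF] s(2)
      by (metis UNIV_I le_less_trans)
    show "y \<sqsubset> \<alpha>" if "x \<sqsubset> \<alpha>" "y \<in> \<Phi> x" for x y
      using below[OF that(1)] nx(2)[OF sF _ that(2)] a s(2) by (metis less_trans)
  qed
qed

lemma limit_point_cong:
  assumes "\<And>a. a \<sqsubset> \<delta> \<Longrightarrow> a \<in> A \<longleftrightarrow> a \<in> B"
  shows "limit_point A \<delta> \<longleftrightarrow> limit_point B \<delta>"
  using assms unfolding limit_point_def by blast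

lemma limit_point_mono: "limit_point A \<delta> \<Longrightarrow> A \<subseteq> B \<Longrightarrow> limit_point B \<delta>"
  unfolding limit_point_def by blast

lemma greatest_limit_point:
  assumes "limit_point A \<delta>" "\<delta> \<sqsubseteq> \<beta>"
  obtains \<sigma> where "limit_point A \<sigma>" "\<delta> \<sqsubseteq> \<sigma>" "\<sigma> \<sqsubseteq> \<beta>"
    "\<And>\<delta>'. limit_point A \<delta>' \<Longrightarrow> \<delta>' \<sqsubseteq> \<beta> \<Longrightarrow> \<delta>' \<sqsubseteq> \<sigma>"
proof -
  define U where "U = (\<lambda>s. \<forall>\<delta>'. limit_point A \<delta>' \<longrightarrow> \<delta>' \<sqsubseteq> \<beta> \<longrightarrow> \<delta>' \<sqsubseteq> s)"
  define \<sigma> where "\<sigma> = least U"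
  have "U \<beta>" by (simp add: U_def)
  then have U: "U \<sigma>" and "\<sigma> \<sqsubseteq> \<beta>"
    unfolding \<sigma>_def by (auto intro: LeastI Least_le)
  have "\<exists>a\<in>A. \<xi> \<sqsubset> a \<and> a \<sqsubset> \<sigma>" if "\<xi> \<sqsubset> \<sigma>" for \<xi>
  proof -
    have "\<not> U \<xi>" using that not_less_Least unfolding \<sigma>_def by blast
    then obtain \<delta>' where d: "limit_point A \<delta>'" "\<delta>' \<sqsubseteq> \<beta>" "\<xi> \<sqsubset> \<delta>'"
      by (auto simp: U_def not_le)
    then obtain a where "a \<in> A" "\<xi> \<sqsubset> a" "a \<sqsubset> \<delta>'"
      unfolding limit_point_def by blast
    moreover have "\<delta>' \<sqsubseteq> \<sigma>" using U d by (simp add: U_def)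
    ultimately show ?thesis using less_le_trans by blast
  qed
  moreover have "\<delta> \<sqsubseteq> \<sigma>" using U assms by (simp add: U_def)
  moreover have "\<exists>\<xi>. \<xi> \<sqsubset> \<sigma>"
    using assms(1) \<open>\<delta> \<sqsubseteq> \<sigma>\<close> less_le_trans unfolding limit_point_def by blast
  ultimately show thesis
    using that \<open>\<sigma> \<sqsubseteq> \<beta>\<close> U unfolding limit_point_def U_def by blast
qed

text \<open>
  The least \<open>\<delta>\<close> below which infinitely many of the points of \<open>A\<close> from \<open>\<xi>\<close> on occur is a limit point of
  these, since only finitely many of them precede any smaller ordinal.
\<close>

lemma infinite_limit_point:
  assumes "infinite {a \<in> A. \<xi> \<sqsubseteq> a \<and> a \<sqsubset> \<beta>}"
  shows "\<exists>\<delta>. limit_point A \<delta> \<and> \<xi> \<sqsubset> \<delta> \<and> \<delta> \<sqsubseteq> \<beta>"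
proof -
  define I where "I = (\<lambda>\<delta>. infinite {a \<in> A. \<xi> \<sqsubseteq> a \<and> a \<sqsubset> \<delta>})"
  define \<delta> where "\<delta> = least I"
  have "I \<beta>" using assms by (simp add: I_def)
  then have I: "I \<delta>" and "\<delta> \<sqsubseteq> \<beta>"
    unfolding \<delta>_def by (auto intro: LeastI Least_le)
  have "\<xi> \<sqsubset> \<delta>"
  proof (rule ccontr)
    assume "\<not> \<xi> \<sqsubset> \<delta>"
    then have "{a \<in> A. \<xi> \<sqsubseteq> a \<and> a \<sqsubset> \<delta>} = {}" by force
    with I show False by (simp add: I_def)
  qed
  have "\<exists>a\<in>A. \<zeta> \<sqsubset> a \<and> a \<sqsubset> \<delta>" if "\<zeta> \<sqsubset> \<delta>" for \<zeta>
  proof (rule ccontr)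
    assume no: "\<not> ?thesis"
    have "finite {a \<in> A. \<xi> \<sqsubseteq> a \<and> a \<sqsubset> \<zeta>}"
      using that not_less_Least unfolding \<delta>_def I_def by blast
    moreover have "{a \<in> A. \<xi> \<sqsubseteq> a \<and> a \<sqsubset> \<delta>} \<subseteq> insert \<zeta> {a \<in> A. \<xi> \<sqsubseteq> a \<and> a \<sqsubset> \<zeta>}"
      using no by force
    ultimately show False
      using I unfolding I_def using finite_subset by blast
  qed
  then show ?thesis
    using \<open>\<xi> \<sqsubset> \<delta>\<close> \<open>\<delta> \<sqsubseteq> \<beta>\<close> unfolding limit_point_def by blast
qed

text \<open>
  The points of \<open>A\<close> below \<open>\<alpha>\<close>, starting from the last limit point of \<open>A\<close> up to \<open>\<alpha>\<close>: the final, finite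
  piece of \<open>A\<close> below \<open>\<alpha>\<close>. It is empty if \<open>\<alpha>\<close> itself is a limit point of \<open>A\<close>.
\<close>

definition last_block :: "'a set \<Rightarrow> 'a \<Rightarrow> 'a set" where
  "last_block A \<alpha> = {\<xi> \<in> A. \<xi> \<sqsubset> \<alpha> \<and> (\<forall>\<delta>. limit_point A \<delta> \<longrightarrow> \<delta> \<sqsubseteq> \<alpha> \<longrightarrow> \<delta> \<sqsubseteq> \<xi>)}"

lemma finite_last_block: "finite (last_block A \<alpha>)"
proof (cases "last_block A \<alpha> = {}")
  case False
  define \<xi> where "\<xi> = least (\<lambda>x. x \<in> last_block A \<alpha>)"
  have xi: "\<xi> \<in> last_block A \<alpha>" "\<And>x. x \<in> last_block A \<alpha> \<Longrightarrow> \<xi> \<sqsubseteq> x"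
    using False unfolding \<xi>_def by (auto intro: LeastI Least_le)
  then have "last_block A \<alpha> \<subseteq> {a \<in> A. \<xi> \<sqsubseteq> a \<and> a \<sqsubset> \<alpha>}"
    by (auto simp: last_block_def)
  moreover have "finite {a \<in> A. \<xi> \<sqsubseteq> a \<and> a \<sqsubset> \<alpha>}"
    using infinite_limit_point[of A \<xi> \<alpha>] xi(1) by (fastforce simp: last_block_def)
  ultimately show ?thesis
    by (rule finite_subset)
qed simp

lemma last_block_cong:
  assumes "\<And>\<xi>. \<xi> \<sqsubset> \<alpha> \<Longrightarrow> \<xi> \<in> A \<longleftrightarrow> \<xi> \<in> B"
  shows "last_block A \<alpha> = last_block B \<alpha>"
proof -
  have "limit_point A \<delta> \<longleftrightarrow> limit_point B \<delta>" if "\<delta> \<sqsubseteq> \<alpha>" for \<delta>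
    by (rule limit_point_cong) (use that assms less_le_trans in blast)
  then show ?thesis
    using assms unfolding last_block_def by auto
qed

end

section \<open>Stationary fibres of a square sequence\<close>

context regular_uncountable
begin

lemma unboundedD: "unbounded X \<Longrightarrow> \<xi> \<in> Field \<kappa> \<Longrightarrow> \<exists>x. x \<in> X \<and> x \<in> Field \<kappa> \<and> \<xi> \<sqsubset> x"
  unfolding unbounded_def by blast

lemma unbounded_Field: "unbounded (Field \<kappa>)"
  using no_maximum by (auto simp: unbounded_def)

lemma unbounded_limit_points:
  assumes X: "unbounded X"
  shows "unbounded {\<delta> \<in> Field \<kappa>. limit_point X \<delta>}"
  unfolding unbounded_def
proof (intro conjI ballI)
  fix \<xi> assume xi: "\<xi> \<in> Field \<kappa>"
  obtain e where e: "\<And>x. x \<in> Field \<kappa> \<Longrightarrow> e x \<in> X \<and> e x \<in> Field \<kappa> \<and> x \<sqsubset> e x"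
    using unboundedD[OF X] by metis
  have "{e x} \<subseteq> Field \<kappa> \<and> |{e x}| <o \<kappa>" if "x \<in> Field \<kappa>" for x
    using e[OF that] small_finite[of "{e x}"] by simp
  then obtain \<alpha> where a: "\<alpha> \<in> Field \<kappa>" "\<xi> \<sqsubset> \<alpha>" "\<And>x y. x \<sqsubset> \<alpha> \<Longrightarrow> y \<in> {e x} \<Longrightarrow> y \<sqsubset> \<alpha>"
    using closed_under_unbounded[of "\<lambda>x. {e x}" \<xi>] xi by metis
  have "limit_point X \<alpha>"
    unfolding limit_point_def using a e Field_down'[OF a(1)] by blast
  with a show "\<exists>x\<in>{\<delta> \<in> Field \<kappa>. limit_point X \<delta>}. \<xi> \<sqsubset> x"
    by blast
qed blast

end

text \<open>
  A \<open>\<square>(\<kappa>)\<close>-sequence, stated with limit points. In \<open>no_thread\<close> the set \<open>D\<close> is closed, so its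
  limit points below \<open>\<kappa>\<close> are the elements of \<open>acc(D)\<close>.
\<close>

locale square_sequence = regular_uncountable +
  fixes C :: "'a \<Rightarrow> 'a set"
  assumes C_below: "\<lbrakk>\<alpha> \<in> Field \<kappa>; limit_point UNIV \<alpha>; \<xi> \<in> C \<alpha>\<rbrakk> \<Longrightarrow> \<xi> \<sqsubset> \<alpha>"
    and C_unbounded: "\<lbrakk>\<alpha> \<in> Field \<kappa>; limit_point UNIV \<alpha>\<rbrakk> \<Longrightarrow> limit_point (C \<alpha>) \<alpha>"
    and C_closed: "\<lbrakk>\<alpha> \<in> Field \<kappa>; limit_point UNIV \<alpha>; limit_point (C \<alpha>) \<gamma>; \<gamma> \<sqsubset> \<alpha>\<rbrakk> \<Longrightarrow> \<gamma> \<in> C \<alpha>"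
    and C_coherent: "\<lbrakk>\<alpha> \<in> Field \<kappa>; limit_point UNIV \<alpha>; limit_point (C \<alpha>) \<gamma>; \<gamma> \<sqsubset> \<alpha>\<rbrakk>
      \<Longrightarrow> C \<gamma> = {\<xi> \<in> C \<alpha>. \<xi> \<sqsubset> \<gamma>}"
    and no_thread: "\<lbrakk>unbounded D; \<And>\<gamma>. \<lbrakk>\<gamma> \<in> Field \<kappa>; limit_point D \<gamma>\<rbrakk> \<Longrightarrow> \<gamma> \<in> D\<rbrakk>
      \<Longrightarrow> \<exists>\<gamma>\<in>Field \<kappa>. limit_point D \<gamma> \<and> {\<xi> \<in> D. \<xi> \<sqsubset> \<gamma>} \<noteq> C \<gamma>"
begin

text \<open>
  The limit ordinals \<open>\<alpha> > \<epsilon>\<close> with \<open>min(C\<^sub>\<alpha> - \<epsilon>) = \<eta>\<close>.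
\<close>

definition fibre :: "'a \<Rightarrow> 'a \<Rightarrow> 'a set" where
  "fibre \<epsilon> \<eta> = {\<alpha> \<in> Field \<kappa>. limit_point UNIV \<alpha> \<and> \<epsilon> \<sqsubset> \<alpha> \<and>
     \<eta> \<in> C \<alpha> \<and> \<epsilon> \<sqsubseteq> \<eta> \<and> (\<forall>\<xi>\<in>C \<alpha>. \<epsilon> \<sqsubseteq> \<xi> \<longrightarrow> \<eta> \<sqsubseteq> \<xi>)}"

lemma fibre_unique: "\<alpha> \<in> fibre \<epsilon> \<eta> \<Longrightarrow> \<alpha> \<in> fibre \<epsilon> \<eta>' \<Longrightarrow> \<eta> = \<eta>'"
  by (auto simp: fibre_def intro: order.antisym)

lemma fibre_exists:
  assumes "\<alpha> \<in> Field \<kappa>" "limit_point UNIV \<alpha>" "\<epsilon> \<sqsubset> \<alpha>"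
  shows "\<exists>\<eta>. \<alpha> \<in> fibre \<epsilon> \<eta>"
proof -
  define \<eta> where "\<eta> = least (\<lambda>x. x \<in> C \<alpha> \<and> \<epsilon> \<sqsubseteq> x)"
  have "\<exists>x. x \<in> C \<alpha> \<and> \<epsilon> \<sqsubseteq> x"
    using C_unbounded[OF assms(1,2)] assms(3) less_imp_le unfolding limit_point_def by blast
  then have "\<eta> \<in> C \<alpha> \<and> \<epsilon> \<sqsubseteq> \<eta>" "\<And>x. x \<in> C \<alpha> \<Longrightarrow> \<epsilon> \<sqsubseteq> x \<Longrightarrow> \<eta> \<sqsubseteq> x"
    unfolding \<eta>_def by (rule LeastI_ex) (auto intro: Least_le)
  then show ?thesis
    using assms by (auto simp: fibre_def)
qed

text \<open>
  Otherwise, for every \<open>\<epsilon>\<close>, the values \<open>\<eta>\<close> with stationary fibre are bounded by some \<open>\<mu>(\<epsilon>)\<close>. Let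
  \<open>E\<close> consist of the limit ordinals closed under \<open>\<mu>\<close> and under witnesses for the non-stationarity of the
  other fibres. For \<open>\<alpha> \<in> E\<close> and \<open>\<epsilon> < \<alpha>\<close> the set \<open>C\<^sub>\<alpha>\<close> then has a point in \<open>[\<epsilon>, \<mu>(\<epsilon>)]\<close>. So \<open>C\<^sub>\<alpha>\<close>
  accumulates at every limit point \<open>\<delta> < \<alpha>\<close> of \<open>E\<close>, whence \<open>C\<^sub>\<delta> = C\<^sub>\<alpha> \<inter> \<delta>\<close>, and the union of these \<open>C\<^sub>\<delta>\<close>
  is a thread.
\<close>

lemma unbounded_stationary_fibres:
  "\<exists>\<epsilon>\<in>Field \<kappa>. unbounded {\<eta> \<in> Field \<kappa>. stationary (fibre \<epsilon> \<eta>)}"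
proof (rule ccontr)
  assume "\<not> ?thesis"
  then have "\<forall>\<epsilon>\<in>Field \<kappa>. \<exists>\<mu>\<in>Field \<kappa>. \<forall>\<eta>\<in>Field \<kappa>. \<mu> \<sqsubset> \<eta> \<longrightarrow> \<not> stationary (fibre \<epsilon> \<eta>)"
    unfolding unbounded_def by blast
  then obtain \<mu> where mu: "\<And>\<epsilon>. \<epsilon> \<in> Field \<kappa> \<Longrightarrow> \<mu> \<epsilon> \<in> Field \<kappa>"
    and nonstat: "\<And>\<epsilon> \<eta>. \<lbrakk>\<epsilon> \<in> Field \<kappa>; \<eta> \<in> Field \<kappa>; \<mu> \<epsilon> \<sqsubset> \<eta>\<rbrakk> \<Longrightarrow> \<not> stationary (fibre \<epsilon> \<eta>)"
    by metis
  have "\<exists>X. unbounded X \<and> (\<epsilon> \<in> Field \<kappa> \<longrightarrow> \<eta> \<in> Field \<kappa> \<longrightarrow> \<mu> \<epsilon> \<sqsubset> \<eta> \<longrightarrow>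
      (\<forall>\<delta>\<in>fibre \<epsilon> \<eta>. \<not> limit_point X \<delta>))" for \<epsilon> \<eta>
    using nonstat[of \<epsilon> \<eta>] unbounded_Field by (auto simp: stationary_def fibre_def)
  then obtain X where X: "\<And>\<epsilon> \<eta>. unbounded (X \<epsilon> \<eta>)"
    and X_avoids: "\<And>\<epsilon> \<eta> \<delta>. \<lbrakk>\<epsilon> \<in> Field \<kappa>; \<eta> \<in> Field \<kappa>; \<mu> \<epsilon> \<sqsubset> \<eta>; \<delta> \<in> fibre \<epsilon> \<eta>\<rbrakk>
      \<Longrightarrow> \<not> limit_point (X \<epsilon> \<eta>) \<delta>"
    by metis
  define \<phi> where "\<phi> = (\<lambda>\<epsilon> \<eta> \<xi>. SOME x. x \<in> X \<epsilon> \<eta> \<and> x \<in> Field \<kappa> \<and> \<xi> \<sqsubset> x)"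
  have phi: "\<phi> \<epsilon> \<eta> \<xi> \<in> X \<epsilon> \<eta> \<and> \<phi> \<epsilon> \<eta> \<xi> \<in> Field \<kappa> \<and> \<xi> \<sqsubset> \<phi> \<epsilon> \<eta> \<xi>" if "\<xi> \<in> Field \<kappa>" for \<epsilon> \<eta> \<xi>
    unfolding \<phi>_def by (rule someI_ex) (rule unboundedD[OF X that])
  define \<Phi> where "\<Phi> = (\<lambda>x. insert (\<mu> x)
    ((\<lambda>(\<epsilon>, \<eta>, \<xi>). \<phi> \<epsilon> \<eta> \<xi>) ` ({y. y \<sqsubseteq> x} \<times> {y. y \<sqsubseteq> x} \<times> {y. y \<sqsubseteq> x})))"
  have \<Phi>: "\<Phi> x \<subseteq> Field \<kappa> \<and> |\<Phi> x| <o \<kappa>" if x: "x \<in> Field \<kappa>" for x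
  proof
    show "\<Phi> x \<subseteq> Field \<kappa>"
      using mu[OF x] phi Field_down[OF x] by (auto simp: \<Phi>_def)
    have "|{\<mu> x} \<union> (\<lambda>(\<epsilon>, \<eta>, \<xi>). \<phi> \<epsilon> \<eta> \<xi>) ` ({y. y \<sqsubseteq> x} \<times> {y. y \<sqsubseteq> x} \<times> {y. y \<sqsubseteq> x})| <o \<kappa>"
      by (intro small_Un small_image small_Times small_atMost x) (simp add: small_finite)
    then show "|\<Phi> x| <o \<kappa>"
      by (simp add: \<Phi>_def)
  qed
  define E where "E = {\<alpha> \<in> Field \<kappa>. limit_point UNIV \<alpha> \<and> (\<forall>x y. x \<sqsubset> \<alpha> \<longrightarrow> y \<in> \<Phi> x \<longrightarrow> y \<sqsubset> \<alpha>)}"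
  have E: "unbounded E"
    unfolding unbounded_def
  proof (intro conjI ballI)
    fix \<xi> assume "\<xi> \<in> Field \<kappa>"
    from closed_under_unbounded[of \<Phi>, OF \<Phi> this] show "\<exists>x\<in>E. \<xi> \<sqsubset> x"
      unfolding E_def by (smt (verit) mem_Collect_eq)
  qed (auto simp: E_def)
  \<comment> \<open>The ordinal \<open>\<alpha>\<close> is a limit point of every witness \<open>X \<epsilon> \<eta>\<close> with \<open>\<epsilon>, \<eta> < \<alpha>\<close>, so it lies in no fibre \<open>fibre \<epsilon> \<eta>\<close> with \<open>\<mu> \<epsilon> < \<eta>\<close>.\<close>
  have dense: "\<exists>\<eta>\<in>C \<alpha>. \<epsilon> \<sqsubseteq> \<eta> \<and> \<eta> \<sqsubseteq> \<mu> \<epsilon>" if \<alpha>: "\<alpha> \<in> E" and \<epsilon>: "\<epsilon> \<sqsubset> \<alpha>" for \<alpha> \<epsilon>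
  proof -
    have aF: "\<alpha> \<in> Field \<kappa>" "limit_point UNIV \<alpha>" and cl: "\<And>x y. x \<sqsubset> \<alpha> \<Longrightarrow> y \<in> \<Phi> x \<Longrightarrow> y \<sqsubset> \<alpha>"
      using \<alpha> by (auto simp: E_def)
    obtain \<eta> where eta: "\<alpha> \<in> fibre \<epsilon> \<eta>"
      using fibre_exists[OF aF \<epsilon>] by blast
    then have "\<eta> \<sqsubset> \<alpha>"
      using C_below[OF aF] by (simp add: fibre_def)
    have "limit_point (X \<epsilon> \<eta>) \<alpha>"
      unfolding limit_point_def
    proof (intro conjI allI impI)
      fix \<xi> assume xi: "\<xi> \<sqsubset> \<alpha>"
      obtain x where x: "x \<sqsubset> \<alpha>" "\<epsilon> \<sqsubseteq> x" "\<eta> \<sqsubseteq> x" "\<xi> \<sqsubseteq> x"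
        using \<epsilon> \<open>\<eta> \<sqsubset> \<alpha>\<close> xi by (metis linear order_trans)
      then have "\<phi> \<epsilon> \<eta> \<xi> \<in> \<Phi> x"
        by (auto simp: \<Phi>_def intro!: rev_image_eqI[of "(\<epsilon>, \<eta>, \<xi>)"])
      then show "\<exists>a\<in>X \<epsilon> \<eta>. \<xi> \<sqsubset> a \<and> a \<sqsubset> \<alpha>"
        using cl[OF x(1)] phi[OF Field_down'[OF aF(1) xi]] by blast
    qed (use \<epsilon> in blast)
    then have "\<not> \<mu> \<epsilon> \<sqsubset> \<eta>"
      using X_avoids[OF _ _ _ eta] \<open>\<eta> \<sqsubset> \<alpha>\<close> \<epsilon> Field_down'[OF aF(1)] by blast
    then show ?thesis
      using eta by (auto simp: fibre_def not_less)
  qed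
  define E' where "E' = {\<delta> \<in> Field \<kappa>. limit_point E \<delta>}"
  have E': "unbounded E'"
    unfolding E'_def by (rule unbounded_limit_points[OF E])
  have E'_limit: "\<delta> \<in> Field \<kappa>" "limit_point UNIV \<delta>" if "\<delta> \<in> E'" for \<delta>
    using that limit_point_mono by (auto simp: E'_def)
  have trace: "C \<delta> = {\<xi> \<in> C \<alpha>. \<xi> \<sqsubset> \<delta>}" if \<delta>: "\<delta> \<in> E'" and \<alpha>: "\<alpha> \<in> E" "\<delta> \<sqsubset> \<alpha>" for \<delta> \<alpha>
  proof -
    have "\<exists>\<eta>\<in>C \<alpha>. \<xi> \<sqsubset> \<eta> \<and> \<eta> \<sqsubset> \<delta>" if xi: "\<xi> \<sqsubset> \<delta>" for \<xi>
    proof -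
      have lim: "\<And>\<zeta>. \<zeta> \<sqsubset> \<delta> \<Longrightarrow> \<exists>e\<in>E. \<zeta> \<sqsubset> e \<and> e \<sqsubset> \<delta>"
        using \<delta> by (simp add: E'_def limit_point_def)
      obtain e where e: "e \<in> E" "\<xi> \<sqsubset> e" "e \<sqsubset> \<delta>"
        using lim[OF xi] by blast
      obtain e' where e': "e' \<in> E" "e \<sqsubset> e'" "e' \<sqsubset> \<delta>"
        using lim[OF e(3)] by blast
      obtain \<eta> where eta: "\<eta> \<in> C \<alpha>" "e \<sqsubseteq> \<eta>" "\<eta> \<sqsubseteq> \<mu> e"
        using dense[OF \<alpha>(1)] e(3) \<alpha>(2) less_trans by blast
      have "\<mu> e \<sqsubset> e'"
        using e' by (auto simp: E_def \<Phi>_def)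
      then show ?thesis
        using eta e e' by (meson le_less_trans less_le_trans less_trans)
    qed
    then have "limit_point (C \<alpha>) \<delta>"
      using E'_limit(2)[OF \<delta>] by (auto simp: limit_point_def)
    then show ?thesis
      using C_coherent \<alpha> by (auto simp: E_def)
  qed
  define D where "D = (\<Union>\<delta>\<in>E'. C \<delta>)"
  have D_below: "\<xi> \<in> D \<longleftrightarrow> \<xi> \<in> C \<delta>" if \<delta>: "\<delta> \<in> E'" and xi: "\<xi> \<sqsubset> \<delta>" for \<delta> \<xi>
  proof
    assume "\<xi> \<in> D"
    then obtain \<delta>' where d: "\<delta>' \<in> E'" "\<xi> \<in> C \<delta>'"
      by (auto simp: D_def)
    obtain \<alpha> where \<alpha>: "\<alpha> \<in> E" "\<delta> \<sqsubset> \<alpha>" "\<delta>' \<sqsubset> \<alpha>"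
      using unboundedD[OF E] E'_limit(1) \<delta> d by (metis linear le_less_trans)
    show "\<xi> \<in> C \<delta>"
      using d(2) xi unfolding trace[OF \<delta> \<alpha>(1,2)] trace[OF d(1) \<alpha>(1,3)] by blast
  qed (use \<delta> in \<open>auto simp: D_def\<close>)
  have "unbounded D"
    unfolding unbounded_def
  proof (intro conjI ballI)
    show "D \<subseteq> Field \<kappa>"
      unfolding D_def using C_below E'_limit Field_down' by blast
    fix \<xi> assume "\<xi> \<in> Field \<kappa>"
    then obtain \<delta> where d: "\<delta> \<in> E'" "\<xi> \<sqsubset> \<delta>"
      using unboundedD[OF E'] by metis
    then show "\<exists>x\<in>D. \<xi> \<sqsubset> x"
      using C_unbounded[OF E'_limit[OF d(1)]] unfolding D_def limit_point_def by blast
  qed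
  have D_limit: "\<gamma> \<in> D \<and> {\<xi> \<in> D. \<xi> \<sqsubset> \<gamma>} = C \<gamma>" if g: "\<gamma> \<in> Field \<kappa>" "limit_point D \<gamma>" for \<gamma>
  proof -
    obtain \<delta> where d: "\<delta> \<in> E'" "\<gamma> \<sqsubset> \<delta>"
      using unboundedD[OF E' g(1)] by metis
    have "limit_point (C \<delta>) \<gamma>"
      using g(2) limit_point_cong[of \<gamma> D "C \<delta>"] D_below[OF d(1)] d(2) less_trans by blast
    then have "\<gamma> \<in> C \<delta>" "C \<gamma> = {\<xi> \<in> C \<delta>. \<xi> \<sqsubset> \<gamma>}"
      using C_closed C_coherent E'_limit[OF d(1)] d(2) by blast+
    then show ?thesis
      using D_below[OF d(1)] d(2) less_trans by blast
  qed
  show False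
    using no_thread[OF \<open>unbounded D\<close>] D_limit by blast
qed

end

section \<open>A subadditive colouring from labelled clubs\<close>

text \<open>
  Unlike in a square sequence, every \<open>\<beta> < \<kappa>\<close> has a closed set \<open>C \<beta>\<close> that is cofinal in \<open>\<beta>\<close>: for a
  successor \<open>\<beta>\<close> it contains the predecessor of \<open>\<beta>\<close>, and \<open>C 0 = {}\<close>. Walks can then start
  anywhere.
\<close>

locale labelled_clubs = regular_uncountable less_eq less \<kappa>
  for less_eq :: "'a \<Rightarrow> 'a \<Rightarrow> bool" (infix "\<sqsubseteq>" 50) and less :: "'a \<Rightarrow> 'a \<Rightarrow> bool" (infix "\<sqsubset>" 50)
    and \<kappa> :: "'a rel" +
  fixes lam :: "'b rel" and C :: "'a \<Rightarrow> 'a set" and h :: "'a \<Rightarrow> 'b"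
  assumes lam: "Cinfinite lam" "lam <o \<kappa>"
    and C_below: "\<lbrakk>\<beta> \<in> Field \<kappa>; \<xi> \<in> C \<beta>\<rbrakk> \<Longrightarrow> \<xi> \<sqsubset> \<beta>"
    and C_cofinal: "\<lbrakk>\<beta> \<in> Field \<kappa>; \<alpha> \<sqsubset> \<beta>\<rbrakk> \<Longrightarrow> \<exists>\<gamma>\<in>C \<beta>. \<alpha> \<sqsubseteq> \<gamma>"
    and C_closed: "\<lbrakk>\<beta> \<in> Field \<kappa>; limit_point (C \<beta>) \<gamma>; \<gamma> \<sqsubset> \<beta>\<rbrakk> \<Longrightarrow> \<gamma> \<in> C \<beta>"
    and C_coherent: "\<lbrakk>\<beta> \<in> Field \<kappa>; limit_point (C \<beta>) \<gamma>; \<gamma> \<sqsubset> \<beta>\<rbrakk> \<Longrightarrow> C \<gamma> = {\<xi> \<in> C \<beta>. \<xi> \<sqsubset> \<gamma>}"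
    and h_Field: "\<beta> \<in> Field \<kappa> \<Longrightarrow> h \<beta> \<in> Field lam"
    and h_coherent: "\<lbrakk>\<beta> \<in> Field \<kappa>; limit_point (C \<beta>) \<gamma>; \<gamma> \<sqsubset> \<beta>\<rbrakk> \<Longrightarrow> h \<gamma> = h \<beta>"
    and h_stationary: "i \<in> Field lam \<Longrightarrow> stationary {\<beta>. (h \<beta>, i) \<notin> lam}"
begin

definition next_point :: "'a set \<Rightarrow> 'a \<Rightarrow> 'a" where
  "next_point A \<alpha> = least (\<lambda>m. m \<in> A \<and> \<alpha> \<sqsubseteq> m)"

lemma next_point:
  assumes "\<exists>m\<in>A. \<alpha> \<sqsubseteq> m"
  shows "next_point A \<alpha> \<in> A" "\<alpha> \<sqsubseteq> next_point A \<alpha>" "\<And>m. m \<in> A \<Longrightarrow> \<alpha> \<sqsubseteq> m \<Longrightarrow> next_point A \<alpha> \<sqsubseteq> m"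
proof -
  have "\<exists>m. m \<in> A \<and> \<alpha> \<sqsubseteq> m" using assms by blast
  then have "next_point A \<alpha> \<in> A \<and> \<alpha> \<sqsubseteq> next_point A \<alpha>"
    unfolding next_point_def by (rule LeastI_ex)
  then show "next_point A \<alpha> \<in> A" "\<alpha> \<sqsubseteq> next_point A \<alpha>" by blast+
  show "next_point A \<alpha> \<sqsubseteq> m" if "m \<in> A" "\<alpha> \<sqsubseteq> m" for m
    unfolding next_point_def by (rule Least_le) (use that in blast)
qed

lemma next_point_eqI: "m \<in> A \<Longrightarrow> \<alpha> \<sqsubseteq> m \<Longrightarrow> (\<And>m'. m' \<in> A \<Longrightarrow> \<alpha> \<sqsubseteq> m' \<Longrightarrow> m \<sqsubseteq> m') \<Longrightarrow> next_point A \<alpha> = m"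
  unfolding next_point_def by (rule Least_equality) blast+

lemma next_point_C:
  assumes "\<beta> \<in> Field \<kappa>" "\<alpha> \<sqsubset> \<beta>"
  shows "next_point (C \<beta>) \<alpha> \<in> C \<beta>" "\<alpha> \<sqsubseteq> next_point (C \<beta>) \<alpha>" "next_point (C \<beta>) \<alpha> \<sqsubset> \<beta>" "next_point (C \<beta>) \<alpha> \<in> Field \<kappa>"
    "\<And>m. m \<in> C \<beta> \<Longrightarrow> \<alpha> \<sqsubseteq> m \<Longrightarrow> next_point (C \<beta>) \<alpha> \<sqsubseteq> m"
proof -
  show *: "next_point (C \<beta>) \<alpha> \<in> C \<beta>" "\<alpha> \<sqsubseteq> next_point (C \<beta>) \<alpha>"
    "\<And>m. m \<in> C \<beta> \<Longrightarrow> \<alpha> \<sqsubseteq> m \<Longrightarrow> next_point (C \<beta>) \<alpha> \<sqsubseteq> m"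
    using next_point[OF C_cofinal[OF assms]] by blast+
  show "next_point (C \<beta>) \<alpha> \<sqsubset> \<beta>"
    using C_below assms(1) *(1) by blast
  then show "next_point (C \<beta>) \<alpha> \<in> Field \<kappa>"
    using Field_down' assms(1) by blast
qed

text \<open>
  \<open>linked j \<alpha> \<beta>\<close> expresses \<open>\<rho>(\<alpha>, \<beta>) \<le> j\<close> for the colouring \<open>\<rho>\<close> of the introduction. Defining the
  relations \<open>\<rho> \<le> j\<close> one at a time, with \<open>j\<close> as a parameter, avoids computing maxima in \<open>lam\<close>; that
  every pair has a colour becomes the lemma \<open>eventually_linked\<close>.
\<close>

inductive linked :: "'b \<Rightarrow> 'a \<Rightarrow> 'a \<Rightarrow> bool" for j where
  linkedI: "\<lbrakk>\<alpha> \<sqsubset> \<beta>; (h \<beta>, j) \<in> lam; next_point (C \<beta>) \<alpha> = \<alpha> \<or> linked j \<alpha> (next_point (C \<beta>) \<alpha>);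
    \<forall>\<xi>. \<xi> \<in> last_block (C \<beta>) \<alpha> \<longrightarrow> linked j \<xi> \<alpha>\<rbrakk> \<Longrightarrow> linked j \<alpha> \<beta>"

lemma linked_iff:
  "linked j \<alpha> \<beta> \<longleftrightarrow> \<alpha> \<sqsubset> \<beta> \<and> (h \<beta>, j) \<in> lam \<and>
     (next_point (C \<beta>) \<alpha> = \<alpha> \<or> linked j \<alpha> (next_point (C \<beta>) \<alpha>)) \<and> (\<forall>\<xi>\<in>last_block (C \<beta>) \<alpha>. linked j \<xi> \<alpha>)"
  by (subst linked.simps) auto

lemma linked_less: "linked j \<alpha> \<beta> \<Longrightarrow> \<alpha> \<sqsubset> \<beta>"
  and linked_label: "linked j \<alpha> \<beta> \<Longrightarrow> (h \<beta>, j) \<in> lam"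
  and linked_next_point: "linked j \<alpha> \<beta> \<Longrightarrow> next_point (C \<beta>) \<alpha> = \<alpha> \<or> linked j \<alpha> (next_point (C \<beta>) \<alpha>)"
  and linked_last_block: "linked j \<alpha> \<beta> \<Longrightarrow> \<xi> \<in> last_block (C \<beta>) \<alpha> \<Longrightarrow> linked j \<xi> \<alpha>"
  using linked_iff by blast+

lemma lam_trans: "(i, j) \<in> lam \<Longrightarrow> (j, k) \<in> lam \<Longrightarrow> (i, k) \<in> lam"
  and lam_refl: "i \<in> Field lam \<Longrightarrow> (i, i) \<in> lam"
  and lam_total: "i \<in> Field lam \<Longrightarrow> j \<in> Field lam \<Longrightarrow> (i, j) \<in> lam \<or> (j, i) \<in> lam"
proof -
  have "Well_order lam" using lam(1) by (auto simp: card_order_on_def)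
  then interpret wo_rel lam by (simp add: wo_rel_def)
  show "(i, j) \<in> lam \<Longrightarrow> (j, k) \<in> lam \<Longrightarrow> (i, k) \<in> lam"
    using TRANS by (auto simp: trans_def)
  show "i \<in> Field lam \<Longrightarrow> (i, i) \<in> lam"
    using REFL by (auto simp: refl_on_def)
  show "i \<in> Field lam \<Longrightarrow> j \<in> Field lam \<Longrightarrow> (i, j) \<in> lam \<or> (j, i) \<in> lam"
    using TOTALS by blast
qed

lemma linked_mono: "linked i \<alpha> \<beta> \<Longrightarrow> (i, j) \<in> lam \<Longrightarrow> linked j \<alpha> \<beta>"
  by (induction rule: linked.induct) (auto intro: linkedI lam_trans)

lemma lam_directed:
  assumes "finite I" "I \<subseteq> Field lam"
  shows "\<exists>j\<in>Field lam. \<forall>i\<in>I. (i, j) \<in> lam"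
  using assms
proof (induction rule: finite_induct)
  case empty
  have "Field lam \<noteq> {}" using lam(1) by (auto simp: cinfinite_def)
  then show ?case by auto
next
  case (insert i I)
  then obtain j where j: "j \<in> Field lam" "\<forall>i\<in>I. (i, j) \<in> lam" by auto
  from insert.prems j(1) consider "(i, j) \<in> lam" | "(j, i) \<in> lam"
    using lam_total by blast
  then show ?case
    using j insert.prems lam_trans lam_refl by cases blast+
qed

lemma eventually_linked:
  "\<beta> \<in> Field \<kappa> \<Longrightarrow> \<alpha> \<sqsubset> \<beta> \<Longrightarrow> \<exists>j\<in>Field lam. linked j \<alpha> \<beta>"
proof (induction \<beta> arbitrary: \<alpha> rule: less_induct)
  case (less \<beta>)
  let ?m = "next_point (C \<beta>) \<alpha>"
  note m = next_point_C[OF less.prems]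
  have "\<exists>j\<in>Field lam. ?m = \<alpha> \<or> linked j \<alpha> ?m"
    using less.IH[OF m(3,4)] le_imp_less_or_eq[OF m(2)] h_Field[OF less.prems(1)] by auto
  then obtain j0 where j0: "j0 \<in> Field lam" "?m = \<alpha> \<or> linked j0 \<alpha> ?m" by blast
  have "\<exists>j\<in>Field lam. linked j \<xi> \<alpha>" if "\<xi> \<in> last_block (C \<beta>) \<alpha>" for \<xi>
    using less.IH[OF less.prems(2) Field_down'[OF less.prems]] that by (auto simp: last_block_def)
  then obtain J where J: "\<And>\<xi>. \<xi> \<in> last_block (C \<beta>) \<alpha> \<Longrightarrow> J \<xi> \<in> Field lam \<and> linked (J \<xi>) \<xi> \<alpha>"
    by metis
  have "finite ({h \<beta>, j0} \<union> J ` last_block (C \<beta>) \<alpha>)" "{h \<beta>, j0} \<union> J ` last_block (C \<beta>) \<alpha> \<subseteq> Field lam"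
    using finite_last_block j0 J h_Field less.prems by auto
  then obtain j where j: "j \<in> Field lam" "\<forall>i\<in>{h \<beta>, j0} \<union> J ` last_block (C \<beta>) \<alpha>. (i, j) \<in> lam"
    using lam_directed by meson
  have "linked j \<alpha> \<beta>"
    by (rule linkedI) (use less.prems j j0 J linked_mono in blast)+
  with j show ?case by blast
qed

text \<open>
  The walk from \<open>\<beta>\<close> to a point below a limit point \<open>\<delta>\<close> of \<open>C \<beta>\<close> makes the same steps as the walk
  from \<open>\<delta>\<close>, since \<open>C \<delta>\<close> is the part of \<open>C \<beta>\<close> below \<open>\<delta>\<close> and unbounded in \<open>\<delta>\<close>;
  the labels of \<open>\<beta>\<close> and \<open>\<delta>\<close> agree as well.
\<close>

lemma linked_coherent:
  assumes "\<beta> \<in> Field \<kappa>" "limit_point (C \<beta>) \<delta>" "\<delta> \<sqsubset> \<beta>" "\<alpha> \<sqsubset> \<delta>"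
  shows "linked j \<alpha> \<delta> \<longleftrightarrow> linked j \<alpha> \<beta>"
proof -
  have C: "C \<delta> = {\<xi> \<in> C \<beta>. \<xi> \<sqsubset> \<delta>}"
    by (rule C_coherent) fact+
  have "\<delta> \<in> Field \<kappa>" using assms Field_down' by blast
  note d = next_point_C[OF this assms(4)]
  have "next_point (C \<beta>) \<alpha> = next_point (C \<delta>) \<alpha>"
  proof (rule next_point_eqI)
    show "next_point (C \<delta>) \<alpha> \<in> C \<beta>" using d(1) C by blast
    show "next_point (C \<delta>) \<alpha> \<sqsubseteq> m" if "m \<in> C \<beta>" "\<alpha> \<sqsubseteq> m" for m
      using d(3,5) that C by (cases "m \<sqsubset> \<delta>") (auto simp: not_less)
  qed (rule d)
  moreover have "last_block (C \<delta>) \<alpha> = last_block (C \<beta>) \<alpha>"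
    by (rule last_block_cong) (use C assms(4) less_trans in blast)
  moreover have "h \<delta> = h \<beta>"
    by (rule h_coherent) fact+
  ultimately show ?thesis
    using assms less_trans by (subst (1 2) linked_iff) auto
qed

text \<open>
  Both subadditivity inequalities at once, at the level \<open>j \<ge> \<rho>(\<beta>, \<gamma>)\<close>. If \<open>C \<gamma>\<close> has a limit point in
  \<open>(\<alpha>, \<beta>]\<close>, let \<open>\<delta>\<close> be the last one: the walks from \<open>\<gamma>\<close> and from \<open>\<delta>\<close> to \<open>\<alpha>\<close> agree, and if \<open>\<delta> < \<beta>\<close>, then \<open>\<delta>\<close>
  is linked to \<open>\<beta>\<close> because it starts the last block of \<open>C \<gamma>\<close> below \<open>\<beta>\<close>. Otherwise the last block below \<open>\<alpha>\<close>
  is part of the one below \<open>\<beta>\<close>, and the first step from \<open>\<gamma>\<close> towards \<open>\<alpha>\<close> leads either into the block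
  below \<open>\<beta>\<close> or to the same point as the first step towards \<open>\<beta>\<close>.
\<close>

lemma linked_subadditive:
  "\<lbrakk>\<gamma> \<in> Field \<kappa>; \<alpha> \<sqsubset> \<beta>; linked j \<beta> \<gamma>\<rbrakk> \<Longrightarrow> linked j \<alpha> \<beta> \<longleftrightarrow> linked j \<alpha> \<gamma>"
proof (induction \<gamma> arbitrary: \<alpha> \<beta> rule: less_induct)
  case (less \<gamma>)
  note g = \<open>\<gamma> \<in> Field \<kappa>\<close> and ab = \<open>\<alpha> \<sqsubset> \<beta>\<close> and bg = \<open>linked j \<beta> \<gamma>\<close>
  have "\<beta> \<sqsubset> \<gamma>" using bg by (rule linked_less)
  have "\<beta> \<in> Field \<kappa>" using g \<open>\<beta> \<sqsubset> \<gamma>\<close> Field_down' by blast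
  have "\<alpha> \<sqsubset> \<gamma>" using ab \<open>\<beta> \<sqsubset> \<gamma>\<close> by (rule less_trans)
  note IH\<beta> = less.IH[OF \<open>\<beta> \<sqsubset> \<gamma>\<close> \<open>\<beta> \<in> Field \<kappa>\<close>]
  show ?case
  proof (cases "\<exists>\<delta>. limit_point (C \<gamma>) \<delta> \<and> \<alpha> \<sqsubset> \<delta> \<and> \<delta> \<sqsubseteq> \<beta>")
    case True
    then obtain \<delta>0 where d0: "limit_point (C \<gamma>) \<delta>0" "\<alpha> \<sqsubset> \<delta>0" "\<delta>0 \<sqsubseteq> \<beta>" by blast
    from greatest_limit_point[OF d0(1,3)] obtain \<delta> where
      d: "limit_point (C \<gamma>) \<delta>" "\<delta>0 \<sqsubseteq> \<delta>" "\<delta> \<sqsubseteq> \<beta>"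
      and max: "\<And>\<delta>'. limit_point (C \<gamma>) \<delta>' \<Longrightarrow> \<delta>' \<sqsubseteq> \<beta> \<Longrightarrow> \<delta>' \<sqsubseteq> \<delta>"
      by blast
    have ad: "\<alpha> \<sqsubset> \<delta>" using d0(2) d(2) by (rule less_le_trans)
    have dg: "\<delta> \<sqsubset> \<gamma>" using d(3) \<open>\<beta> \<sqsubset> \<gamma>\<close> by (rule le_less_trans)
    have eq: "linked j \<alpha> \<delta> \<longleftrightarrow> linked j \<alpha> \<gamma>"
      by (rule linked_coherent) fact+
    show ?thesis
    proof (cases "\<delta> = \<beta>")
      case False
      then have "\<delta> \<in> last_block (C \<gamma>) \<beta>"
        using C_closed[OF g d(1) dg] d(3) max by (auto simp: last_block_def)
      then have "linked j \<delta> \<beta>"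
        by (rule linked_last_block[OF bg])
      then show ?thesis
        using IH\<beta>[OF ad] eq by blast
    qed (use eq in simp)
  next
    case False
    then have lim: "\<delta> \<sqsubseteq> \<alpha>" if "limit_point (C \<gamma>) \<delta>" "\<delta> \<sqsubseteq> \<beta>" for \<delta>
      using that by (auto simp: not_less)
    have last_block\<alpha>: "linked j \<xi> \<beta>" if "\<xi> \<in> last_block (C \<gamma>) \<alpha>" for \<xi>
    proof -
      have "\<xi> \<in> last_block (C \<gamma>) \<beta>"
        using that lim ab unfolding last_block_def by (auto intro: less_trans)
      then show ?thesis by (rule linked_last_block[OF bg])
    qed
    have block_iff: "(\<forall>\<xi>\<in>last_block (C \<gamma>) \<alpha>. linked j \<xi> \<alpha>) \<longleftrightarrow> True" if "linked j \<alpha> \<beta>"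
      using IH\<beta>[OF _ that] last_block\<alpha> by (auto simp: last_block_def)
    let ?a = "next_point (C \<gamma>) \<alpha>" and ?b = "next_point (C \<gamma>) \<beta>"
    note a = next_point_C[OF g \<open>\<alpha> \<sqsubset> \<gamma>\<close>] and b = next_point_C[OF g \<open>\<beta> \<sqsubset> \<gamma>\<close>]
    have next_eq: "linked j \<alpha> \<beta> \<longleftrightarrow> (?a = \<alpha> \<or> linked j \<alpha> ?a)"
    proof (cases "?a \<sqsubset> \<beta>")
      case True
      have "?a \<in> last_block (C \<gamma>) \<beta>"
        using a(1,2) True lim order_trans unfolding last_block_def by blast
      then have l: "linked j ?a \<beta>" by (rule linked_last_block[OF bg])
      then show ?thesis
        using IH\<beta>[of \<alpha> ?a] le_imp_less_or_eq[OF a(2)] by auto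
    next
      case False
      then have "?a = ?b"
        using a b ab by (intro order.antisym a(5) b(5)) (auto simp: not_less)
      moreover have "\<alpha> \<noteq> ?b" using b(2) ab by auto
      ultimately show ?thesis
        using linked_next_point[OF bg] less.IH[OF b(3,4) ab] by auto
    qed
    have "linked j \<alpha> \<gamma> \<longleftrightarrow> (?a = \<alpha> \<or> linked j \<alpha> ?a) \<and> (\<forall>\<xi>\<in>last_block (C \<gamma>) \<alpha>. linked j \<xi> \<alpha>)"
      using linked_iff[of j \<alpha> \<gamma>] \<open>\<alpha> \<sqsubset> \<gamma>\<close> linked_label[OF bg] by blast
    then show ?thesis
      using next_eq block_iff by blast
  qed
qed

text \<open>
  If \<open>\<delta>\<close> is a limit point of \<open>C \<beta>\<close>, then \<open>\<rho>(\<delta>, \<beta>) = h(\<beta>)\<close>. Otherwise \<open>C \<beta>\<close> has no points in an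
  interval \<open>(\<zeta>, \<delta>)\<close>, so all \<open>\<alpha>\<close> in this interval share with \<open>\<delta>\<close> the first step of the walk, to which
  the induction hypothesis applies, and the last block of \<open>C \<beta>\<close>.
\<close>

lemma linked_closed:
  "\<lbrakk>\<beta> \<in> Field \<kappa>; \<delta> \<sqsubset> \<beta>; limit_point {\<alpha>. linked j \<alpha> \<beta>} \<delta>\<rbrakk> \<Longrightarrow> linked j \<delta> \<beta>"
proof (induction \<beta> rule: less_induct)
  case (less \<beta>)
  note b = \<open>\<beta> \<in> Field \<kappa>\<close> and db = \<open>\<delta> \<sqsubset> \<beta>\<close>
  have dF: "\<delta> \<in> Field \<kappa>" using b db Field_down' by blast
  have lim: "\<exists>\<alpha>. linked j \<alpha> \<beta> \<and> \<xi> \<sqsubset> \<alpha> \<and> \<alpha> \<sqsubset> \<delta>" if "\<xi> \<sqsubset> \<delta>" for \<xi>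
    using less.prems(3) that by (auto simp: limit_point_def)
  obtain \<xi>0 where xi0: "\<xi>0 \<sqsubset> \<delta>"
    using less.prems(3) by (auto simp: limit_point_def)
  have label: "(h \<beta>, j) \<in> lam"
    using lim[OF xi0] linked_label by blast
  show ?case
  proof (cases "limit_point (C \<beta>) \<delta>")
    case True
    have "next_point (C \<beta>) \<delta> = \<delta>"
      using C_closed[OF b True db] by (intro next_point_eqI) auto
    moreover have "last_block (C \<beta>) \<delta> = {}"
      using True by (auto simp: last_block_def not_le[symmetric])
    ultimately show ?thesis
      using db label by (subst linked_iff) auto
  next
    case False
    then obtain \<zeta> where zeta: "\<zeta> \<sqsubset> \<delta>" "\<And>a. a \<in> C \<beta> \<Longrightarrow> \<zeta> \<sqsubset> a \<Longrightarrow> \<not> a \<sqsubset> \<delta>"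
      using xi0 by (auto simp: limit_point_def)
    let ?m = "next_point (C \<beta>) \<delta>"
    note m = next_point_C[OF b db]
    have no_lim: "\<not> limit_point (C \<beta>) \<delta>'" if "\<zeta> \<sqsubset> \<delta>'" "\<delta>' \<sqsubseteq> \<delta>" for \<delta>'
      using that zeta less_le_trans unfolding limit_point_def by metis
    have next_eq: "next_point (C \<beta>) \<alpha> = ?m" if "\<zeta> \<sqsubset> \<alpha>" "\<alpha> \<sqsubset> \<delta>" for \<alpha>
    proof (rule next_point_eqI)
      show "\<alpha> \<sqsubseteq> ?m" using that m(2) by (meson less_imp_le order_trans)
      show "?m \<sqsubseteq> m'" if "m' \<in> C \<beta>" "\<alpha> \<sqsubseteq> m'" for m'
        using m(5) that zeta(2) \<open>\<zeta> \<sqsubset> \<alpha>\<close> less_le_trans not_less by metis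
    qed (rule m)
    have block_eq: "last_block (C \<beta>) \<delta> \<subseteq> last_block (C \<beta>) \<alpha>" if "\<zeta> \<sqsubset> \<alpha>" "\<alpha> \<sqsubset> \<delta>" for \<alpha>
    proof
      fix \<xi> assume xi: "\<xi> \<in> last_block (C \<beta>) \<delta>"
      then have "\<xi> \<sqsubseteq> \<zeta>" using zeta(2) by (auto simp: last_block_def not_less[symmetric])
      then show "\<xi> \<in> last_block (C \<beta>) \<alpha>"
        using xi that le_less_trans order_trans less_imp_le unfolding last_block_def by blast
    qed
    have below: "linked j \<alpha> ?m" if "linked j \<alpha> \<beta>" "\<zeta> \<sqsubset> \<alpha>" "\<alpha> \<sqsubset> \<delta>" for \<alpha>
      using linked_next_point[OF that(1)] next_eq[OF that(2,3)] m(2) that(3) by auto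
    have dm: "?m = \<delta> \<or> linked j \<delta> ?m"
    proof (cases "?m = \<delta>")
      case False
      have "limit_point {\<alpha>. linked j \<alpha> ?m} \<delta>"
        unfolding limit_point_def
      proof (intro conjI allI impI)
        fix \<xi> assume "\<xi> \<sqsubset> \<delta>"
        then obtain \<xi>' where "\<xi>' \<sqsubset> \<delta>" "\<xi> \<sqsubseteq> \<xi>'" "\<zeta> \<sqsubseteq> \<xi>'"
          using zeta(1) by (metis linear)
        then show "\<exists>a\<in>{\<alpha>. linked j \<alpha> ?m}. \<xi> \<sqsubset> a \<and> a \<sqsubset> \<delta>"
          using lim[of \<xi>'] below le_less_trans by (metis mem_Collect_eq)
      qed (use xi0 in blast)
      then show ?thesis
        using less.IH[OF m(3,4)] m(2) False by auto
    qed simp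
    have "linked j \<xi> \<delta>" if xi: "\<xi> \<in> last_block (C \<beta>) \<delta>" for \<xi>
    proof -
      obtain \<alpha> where a: "linked j \<alpha> \<beta>" "\<zeta> \<sqsubset> \<alpha>" "\<alpha> \<sqsubset> \<delta>"
        using lim[OF zeta(1)] by blast
      have "linked j \<alpha> \<delta>"
        using below[OF a] dm linked_subadditive[OF m(4) a(3)] by auto
      moreover have "linked j \<xi> \<alpha>"
        using linked_last_block[OF a(1)] block_eq[OF a(2,3)] xi by blast
      ultimately show ?thesis
        using linked_subadditive[OF dF] linked_less by blast
    qed
    then show ?thesis
      using db label dm by (subst linked_iff) auto
  qed
qed

text \<open>
  By closure every limit point \<open>\<delta>\<close> of such a set \<open>X\<close> is linked to later elements of \<open>X\<close>, hence by
  subadditivity elements of \<open>X\<close> below \<open>\<delta>\<close> are linked to \<open>\<delta>\<close>, so that \<open>h \<delta> \<le> j\<close>. But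
  \<open>X\<close> has a limit point in the stationary set of the \<open>\<delta>\<close> with \<open>h \<delta> > j\<close>.
\<close>

lemma no_unbounded_linked:
  assumes "j \<in> Field lam" "unbounded X"
  shows "\<exists>\<alpha>\<in>X. \<exists>\<beta>\<in>X. \<alpha> \<sqsubset> \<beta> \<and> \<not> linked j \<alpha> \<beta>"
proof (rule ccontr)
  assume no: "\<not> ?thesis"
  obtain \<delta> where d: "(h \<delta>, j) \<notin> lam" "\<delta> \<in> Field \<kappa>" "limit_point X \<delta>"
    using h_stationary[OF assms(1)] assms(2) by (auto simp: stationary_def)
  obtain \<beta> where b: "\<beta> \<in> X" "\<beta> \<in> Field \<kappa>" "\<delta> \<sqsubset> \<beta>"
    using unboundedD[OF assms(2) d(2)] by metis
  obtain \<alpha> where a: "\<alpha> \<in> X" "\<alpha> \<sqsubset> \<delta>"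
    using d(3) by (auto simp: limit_point_def)
  have "limit_point {\<alpha>. linked j \<alpha> \<beta>} \<delta>"
    using d(3) no b less_trans unfolding limit_point_def by (metis mem_Collect_eq)
  then have "linked j \<delta> \<beta>"
    by (rule linked_closed[OF b(2,3)])
  then have "linked j \<alpha> \<delta>"
    using linked_subadditive[OF b(2) a(2)] no a b less_trans by blast
  then show False
    using d(1) linked_label by blast
qed

end

section \<open>From a square sequence to labelled clubs\<close>

context square_sequence
begin

text \<open>
  Distinct \<open>i < \<lambda>\<close> are assigned distinct values \<open>e i\<close> with stationary fibre, and \<open>h \<alpha> = i\<close> if
  \<open>min(C \<alpha> - \<epsilon>) = e i\<close>. Passing to \<open>C \<alpha> - \<epsilon>\<close> makes the label coherent: a limit point \<open>\<gamma>\<close> of this set lies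
  above its minimum, which is therefore also the minimum of \<open>C \<gamma> - \<epsilon>\<close>.
\<close>

lemma ex_labelled_clubs:
  fixes lam :: "'b rel"
  assumes lam: "Cinfinite lam" "lam <o \<kappa>"
  obtains C' h where "labelled_clubs (\<sqsubseteq>) (\<sqsubset>) \<kappa> lam C' h"
proof -
  obtain \<epsilon> where eps: "\<epsilon> \<in> Field \<kappa>"
    and unb: "unbounded {\<eta> \<in> Field \<kappa>. stationary (fibre \<epsilon> \<eta>)}" (is "unbounded ?H")
    using unbounded_stationary_fibres by blast
  have "cofinal ?H \<kappa>"
    unfolding cofinal_def
  proof
    fix a assume "a \<in> Field \<kappa>"
    then obtain b where "b \<in> ?H" "a \<sqsubset> b" using unb unfolding unbounded_def by blast
    then show "\<exists>b\<in>?H. a \<noteq> b \<and> (a, b) \<in> \<kappa>"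
      using initial_segment[of b a] by (intro bexI[of _ b]) auto
  qed
  then have "?H \<subseteq> Field \<kappa> \<and> cofinal ?H \<kappa>"
    by auto
  then have "|?H| =o \<kappa>"
    by (rule regular[unfolded regularCard_def, rule_format])
  then have "\<kappa> \<le>o |?H|"
    by (rule ordIso_imp_ordLeq[OF ordIso_symmetric])
  then have "lam \<le>o |?H|"
    using ordLess_imp_ordLeq[OF lam(2)] by (rule ordLeq_transitive[rotated])
  then have "|Field lam| \<le>o |?H|"
    using lam(1) by (auto intro: ordIso_ordLeq_trans[OF card_of_Field_ordIso])
  then obtain e where e: "inj_on e (Field lam)" "e ` Field lam \<subseteq> ?H"
    using card_of_ordLeq[of "Field lam" ?H] by auto
  obtain i0 where i0: "i0 \<in> Field lam"
    using lam(1) by (metis cinfinite_def ex_in_conv finite.emptyI)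
  \<comment> \<open>Up to \<open>\<epsilon>\<close> the whole segment serves as the closed set; the last case is the singleton of the predecessor.\<close>
  define C' where "C' = (\<lambda>\<beta>. if \<beta> \<sqsubseteq> \<epsilon> then {\<xi>. \<xi> \<sqsubset> \<beta>}
    else if limit_point UNIV \<beta> then {\<xi> \<in> C \<beta>. \<epsilon> \<sqsubseteq> \<xi>}
    else {\<xi>. \<xi> \<sqsubset> \<beta> \<and> (\<forall>\<zeta>. \<xi> \<sqsubset> \<zeta> \<longrightarrow> \<not> \<zeta> \<sqsubset> \<beta>)})"
  define h where "h = (\<lambda>\<beta>. if \<exists>i\<in>Field lam. \<beta> \<in> fibre \<epsilon> (e i)
    then SOME i. i \<in> Field lam \<and> \<beta> \<in> fibre \<epsilon> (e i) else i0)"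
  have h_fibre: "h \<beta> = i" if "i \<in> Field lam" "\<beta> \<in> fibre \<epsilon> (e i)" for \<beta> i
  proof -
    have "(SOME i. i \<in> Field lam \<and> \<beta> \<in> fibre \<epsilon> (e i)) = i"
      by (rule some_equality) (use that fibre_unique e(1) inj_onD in \<open>metis+\<close>)
    then show ?thesis using that by (auto simp: h_def)
  qed
  have h_Field: "h \<beta> \<in> Field lam" for \<beta>
  proof (cases "\<exists>i\<in>Field lam. \<beta> \<in> fibre \<epsilon> (e i)")
    case True
    then show ?thesis using h_fibre by metis
  next
    case False
    then show ?thesis using i0 by (simp add: h_def)
  qed
  have h_cong: "h \<gamma> = h \<beta>" if "\<And>\<eta>. \<gamma> \<in> fibre \<epsilon> \<eta> \<longleftrightarrow> \<beta> \<in> fibre \<epsilon> \<eta>" for \<beta> \<gamma>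
    using that by (simp add: h_def)
  have below: "\<xi> \<sqsubset> \<beta>" if "\<beta> \<in> Field \<kappa>" "\<xi> \<in> C' \<beta>" for \<beta> \<xi>
    using that C_below by (auto simp: C'_def split: if_splits)
  have cofinal: "\<exists>\<gamma>\<in>C' \<beta>. \<alpha> \<sqsubseteq> \<gamma>" if b: "\<beta> \<in> Field \<kappa>" and ab: "\<alpha> \<sqsubset> \<beta>" for \<alpha> \<beta>
  proof -
    consider "\<beta> \<sqsubseteq> \<epsilon>" | "\<epsilon> \<sqsubset> \<beta>" "limit_point UNIV \<beta>" | "\<epsilon> \<sqsubset> \<beta>" "\<not> limit_point UNIV \<beta>"
      by (metis not_less)
    then show ?thesis
    proof cases
      case 2
      obtain \<zeta> where "\<alpha> \<sqsubseteq> \<zeta>" "\<epsilon> \<sqsubseteq> \<zeta>" "\<zeta> \<sqsubset> \<beta>"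
        using ab 2(1) by (metis linear)
      moreover then obtain \<gamma> where "\<gamma> \<in> C \<beta>" "\<zeta> \<sqsubset> \<gamma>"
        using C_unbounded[OF b 2(2)] by (auto simp: limit_point_def)
      ultimately show ?thesis
        using 2 by (intro bexI[of _ \<gamma>]) (auto simp: C'_def not_le)
    next
      case 3
      then obtain \<gamma> where g: "\<gamma> \<sqsubset> \<beta>" "\<And>a. \<gamma> \<sqsubset> a \<Longrightarrow> \<not> a \<sqsubset> \<beta>"
        by (auto simp: limit_point_def)
      then have "\<alpha> \<sqsubseteq> \<gamma>" using ab by (meson not_less)
      moreover have "\<gamma> \<in> C' \<beta>" using 3 g by (simp add: C'_def not_le)
      ultimately show ?thesis by blast
    qed (use ab in \<open>auto simp: C'_def\<close>)
  qed
  have coherent: "\<gamma> \<in> C' \<beta> \<and> C' \<gamma> = {\<xi> \<in> C' \<beta>. \<xi> \<sqsubset> \<gamma>} \<and> h \<gamma> = h \<beta>"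
    if b: "\<beta> \<in> Field \<kappa>" and lim: "limit_point (C' \<beta>) \<gamma>" and gb: "\<gamma> \<sqsubset> \<beta>" for \<beta> \<gamma>
  proof -
    obtain a where a: "a \<in> C' \<beta>" "a \<sqsubset> \<gamma>"
      using lim by (auto simp: limit_point_def)
    consider "\<beta> \<sqsubseteq> \<epsilon>" | "\<epsilon> \<sqsubset> \<beta>" "limit_point UNIV \<beta>" | "\<epsilon> \<sqsubset> \<beta>" "\<not> limit_point UNIV \<beta>"
      by (metis not_less)
    then show ?thesis
    proof cases
      case 1
      then have "\<gamma> \<sqsubseteq> \<epsilon>" using gb by simp
      moreover have "h \<gamma> = h \<beta>"
        by (rule h_cong) (use 1 \<open>\<gamma> \<sqsubseteq> \<epsilon>\<close> in \<open>auto simp: fibre_def\<close>)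
      ultimately show ?thesis
        using 1 gb by (auto simp: C'_def)
    next
      case 2
      have C': "C' \<beta> = {\<xi> \<in> C \<beta>. \<epsilon> \<sqsubseteq> \<xi>}"
        using 2 not_le[of \<beta> \<epsilon>] by (simp add: C'_def)
      have "limit_point (C \<beta>) \<gamma>"
        using lim C' limit_point_mono by blast
      then have g: "\<gamma> \<in> C \<beta>" and Cg: "C \<gamma> = {\<xi> \<in> C \<beta>. \<xi> \<sqsubset> \<gamma>}" and lg: "limit_point UNIV \<gamma>"
        using C_closed C_coherent b 2 gb limit_point_mono[OF lim subset_UNIV] by blast+
      have eg: "\<epsilon> \<sqsubset> \<gamma>" using a C' by auto
      have gF: "\<gamma> \<in> Field \<kappa>" using b gb Field_down' by blast
      have C'g: "C' \<gamma> = {\<xi> \<in> C \<gamma>. \<epsilon> \<sqsubseteq> \<xi>}"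
        using eg lg not_le[of \<gamma> \<epsilon>] by (simp add: C'_def)
      have "h \<gamma> = h \<beta>"
      proof (rule h_cong)
        fix \<eta>
        have "\<eta> \<sqsubset> \<gamma>" if "\<beta> \<in> fibre \<epsilon> \<eta>"
          using that a C' by (auto simp: fibre_def intro: le_less_trans)
        moreover have "\<eta> \<sqsubseteq> \<xi>" if "\<eta> \<in> C \<gamma>" "\<xi> \<in> C \<beta>" "\<epsilon> \<sqsubseteq> \<xi>"
          "\<forall>\<xi>\<in>C \<gamma>. \<epsilon> \<sqsubseteq> \<xi> \<longrightarrow> \<eta> \<sqsubseteq> \<xi>" for \<xi>
          using that Cg by (cases "\<xi> \<sqsubset> \<gamma>") (auto simp: not_less)
        ultimately show "\<gamma> \<in> fibre \<epsilon> \<eta> \<longleftrightarrow> \<beta> \<in> fibre \<epsilon> \<eta>"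
          using gF b lg 2 eg Cg by (auto simp: fibre_def)
      qed
      then show ?thesis
        using g C' C'g Cg eg by auto
    next
      case 3
      then have "\<not> \<gamma> \<sqsubset> \<beta>"
        using a not_le[of \<beta> \<epsilon>] by (auto simp: C'_def)
      with gb show ?thesis by blast
    qed
  qed
  have stat: "stationary {\<beta>. (h \<beta>, i) \<notin> lam}" if i: "i \<in> Field lam" for i
  proof -
    \<comment> \<open>An infinite cardinal has no largest element, so some label exceeds \<open>i\<close>, and it occurs stationarily often.\<close>
    obtain i' where i': "i' \<in> Field lam" "i \<noteq> i'" "(i, i') \<in> lam"
      using infinite_Card_order_limit[of lam i] lam(1) i by (auto simp: cinfinite_def)
    have "antisym lam"
      using lam(1) by (auto simp: card_order_on_def well_order_on_def linear_order_on_def partial_order_on_def)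
    then have "(i', i) \<notin> lam"
      using i' by (auto simp: antisym_def)
    then have "fibre \<epsilon> (e i') \<subseteq> {\<beta>. (h \<beta>, i) \<notin> lam}"
      using h_fibre[OF i'(1)] by auto
    moreover have "stationary (fibre \<epsilon> (e i'))"
      using e(2) i'(1) by blast
    ultimately show ?thesis
      unfolding stationary_def by blast
  qed
  have "labelled_clubs (\<sqsubseteq>) (\<sqsubset>) \<kappa> lam C' h"
    by unfold_locales (use lam below cofinal coherent h_Field stat in blast)+
  then show thesis by (rule that)
qed

end

text \<open>
  The translation rests on \<open>supr\<close>: for \<open>\<delta> < \<kappa>\<close>, the supremum of \<open>A \<inter> \<delta>\<close> is a nonzero \<open>\<delta>\<close> exactly if
  \<open>\<delta>\<close> is a limit point of \<open>A\<close>.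
\<close>

lemma square_seq_imp_square_sequence:
  fixes \<kappa> :: "'a rel"
  assumes reg: "regular_uncountable le lt \<kappa>" and sq: "square_seq \<kappa> C"
  shows "square_sequence le lt \<kappa> C"
proof -
  interpret regular_uncountable le lt \<kappa> by fact
  have "Well_order \<kappa>" using Card_order by (auto simp: card_order_on_def)
  then interpret W: wo_rel \<kappa> by (simp add: wo_rel_def)
  have supr: "underS \<kappa> \<delta> \<noteq> {} \<and> W.supr (A \<inter> underS \<kappa> \<delta>) = \<delta> \<longleftrightarrow> limit_point A \<delta>"
    if d: "\<delta> \<in> Field \<kappa>" for A \<delta>
  proof -
    let ?B = "Above \<kappa> (A \<inter> underS \<kappa> \<delta>)"
    have B: "b \<in> ?B \<longleftrightarrow> b \<in> Field \<kappa> \<and> (\<forall>a\<in>A. lt a \<delta> \<longrightarrow> le a b)" for b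
      using initial_segment underS_eq[OF d] by (auto simp: Above_def)
    have dB: "\<delta> \<in> ?B" using d B less_imp_le by blast
    have BF: "?B \<subseteq> Field \<kappa>" using B by blast
    have "W.supr (A \<inter> underS \<kappa> \<delta>) = \<delta> \<longleftrightarrow> (\<forall>b\<in>?B. (\<delta>, b) \<in> \<kappa>)"
    proof
      assume "W.supr (A \<inter> underS \<kappa> \<delta>) = \<delta>"
      then show "\<forall>b\<in>?B. (\<delta>, b) \<in> \<kappa>"
        using W.minim_least[OF BF] by (auto simp: W.supr_def)
    next
      assume "\<forall>b\<in>?B. (\<delta>, b) \<in> \<kappa>"
      then show "W.supr (A \<inter> underS \<kappa> \<delta>) = \<delta>"
        using W.equals_minim[OF BF dB] by (auto simp: W.supr_def)
    qed
    also have "\<dots> \<longleftrightarrow> (\<forall>b\<in>?B. le \<delta> b)"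
      using initial_segment BF by blast
    also have "\<dots> \<longleftrightarrow> (\<forall>\<xi>. lt \<xi> \<delta> \<longrightarrow> (\<exists>a\<in>A. lt \<xi> a \<and> lt a \<delta>))"
      (is "?L \<longleftrightarrow> ?R")
    proof
      assume L: ?L
      show ?R
      proof (intro allI impI)
        fix \<xi> assume "lt \<xi> \<delta>"
        then have "\<xi> \<notin> ?B" "\<xi> \<in> Field \<kappa>"
          using L Field_down'[OF d] by (auto simp: not_less[symmetric])
        then show "\<exists>a\<in>A. lt \<xi> a \<and> lt a \<delta>"
          using B by (auto simp: not_le)
      qed
    next
      assume R: ?R
      show ?L
      proof
        fix b assume "b \<in> ?B"
        then have "\<not> lt b \<delta>"
          using R B by (meson not_le)
        then show "le \<delta> b" by (simp add: not_less)
      qed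
    qed
    finally show ?thesis
      using underS_eq[OF d] by (auto simp: limit_point_def)
  qed
  have acc_iff: "\<alpha> \<in> acc \<kappa> A \<longleftrightarrow> \<alpha> \<in> A \<and> limit_point A \<alpha>" if "A \<subseteq> Field \<kappa>" for A \<alpha>
    using that supr by (auto simp: acc_def)
  have acc_Field: "\<alpha> \<in> acc \<kappa> (Field \<kappa>) \<longleftrightarrow> \<alpha> \<in> Field \<kappa> \<and> limit_point UNIV \<alpha>" for \<alpha>
    using acc_iff[of "Field \<kappa>" \<alpha>] limit_point_cong[of \<alpha> "Field \<kappa>" UNIV] Field_down' by auto
  have clubs: "club \<kappa> (underS \<kappa> \<alpha>) (C \<alpha>)" if "\<alpha> \<in> Field \<kappa>" "limit_point UNIV \<alpha>" for \<alpha>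
    using sq that acc_Field by (auto simp: square_seq_def)
  have traces: "\<forall>\<alpha>\<in>acc \<kappa> (Field \<kappa>). \<forall>\<beta>\<in>acc \<kappa> (Field \<kappa>). \<alpha> \<in> acc \<kappa> (C \<beta>) \<longrightarrow> C \<alpha> = C \<beta> \<inter> underS \<kappa> \<alpha>"
    using sq unfolding square_seq_def by (elim conjE)
  have below: "lt \<xi> \<alpha>" if "\<alpha> \<in> Field \<kappa>" "limit_point UNIV \<alpha>" "\<xi> \<in> C \<alpha>" for \<alpha> \<xi>
    using clubs[OF that(1,2)] that(3) underS_eq[OF that(1)] by (auto simp: club_def)
  have closed: "\<gamma> \<in> C \<alpha>"
    if "\<alpha> \<in> Field \<kappa>" "limit_point UNIV \<alpha>" "limit_point (C \<alpha>) \<gamma>" "lt \<gamma> \<alpha>" for \<alpha> \<gamma>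
    using clubs[OF that(1,2)] supr[OF Field_down'[OF that(1,4)]] that(3,4) underS_eq[OF that(1)]
    by (auto simp: club_def)
  show ?thesis
  proof unfold_locales
    show "limit_point (C \<alpha>) \<alpha>" if a: "\<alpha> \<in> Field \<kappa>" "limit_point UNIV \<alpha>" for \<alpha>
      unfolding limit_point_def
    proof (intro conjI allI impI)
      show "\<exists>\<xi>. lt \<xi> \<alpha>" using a(2) by (auto simp: limit_point_def)
      fix \<xi> assume "lt \<xi> \<alpha>"
      then obtain \<zeta> where z: "lt \<xi> \<zeta>" "lt \<zeta> \<alpha>" using a(2) by (auto simp: limit_point_def)
      then obtain \<gamma> where g: "\<gamma> \<in> C \<alpha>" "(\<zeta>, \<gamma>) \<in> \<kappa>"
        using clubs[OF a] underS_eq[OF a(1)] by (auto simp: club_def)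
      then have "le \<zeta> \<gamma>" using initial_segment FieldI2 by metis
      then show "\<exists>a\<in>C \<alpha>. lt \<xi> a \<and> lt a \<alpha>"
        using z g(1) below[OF a] less_le_trans by blast
    qed
    show "C \<gamma> = {\<xi> \<in> C \<alpha>. lt \<xi> \<gamma>}"
      if a: "\<alpha> \<in> Field \<kappa>" "limit_point UNIV \<alpha>" "limit_point (C \<alpha>) \<gamma>" "lt \<gamma> \<alpha>" for \<alpha> \<gamma>
    proof -
      have gF: "\<gamma> \<in> Field \<kappa>" using Field_down' a by blast
      have "C \<alpha> \<subseteq> Field \<kappa>" using below[OF a(1,2)] Field_down'[OF a(1)] by blast
      then have "\<gamma> \<in> acc \<kappa> (C \<alpha>)" "\<gamma> \<in> acc \<kappa> (Field \<kappa>)" "\<alpha> \<in> acc \<kappa> (Field \<kappa>)"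
        using acc_iff closed[OF a] a acc_Field gF limit_point_mono[OF a(3) subset_UNIV] by auto
      then have "C \<gamma> = C \<alpha> \<inter> underS \<kappa> \<gamma>"
        using traces by blast
      then show ?thesis
        using underS_eq[OF gF] by auto
    qed
    show "\<exists>\<gamma>\<in>Field \<kappa>. limit_point D \<gamma> \<and> {\<xi> \<in> D. lt \<xi> \<gamma>} \<noteq> C \<gamma>"
      if D: "unbounded D" and cl: "\<And>\<gamma>. \<gamma> \<in> Field \<kappa> \<Longrightarrow> limit_point D \<gamma> \<Longrightarrow> \<gamma> \<in> D" for D
    proof -
      have DF: "D \<subseteq> Field \<kappa>" using D by (simp add: unbounded_def)
      have "\<exists>\<gamma>\<in>D. (\<xi>, \<gamma>) \<in> \<kappa>" if "\<xi> \<in> Field \<kappa>" for \<xi>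
        using D that initial_segment less_imp_le unfolding unbounded_def by blast
      then have "club \<kappa> (Field \<kappa>) D"
        using DF cl supr by (auto simp: club_def)
      then obtain \<gamma> where g: "\<gamma> \<in> acc \<kappa> D" "D \<inter> underS \<kappa> \<gamma> \<noteq> C \<gamma>"
        using sq unfolding square_seq_def by blast
      then show ?thesis
        using acc_iff[OF DF, of \<gamma>] DF underS_eq[of \<gamma>] by (intro bexI[of _ \<gamma>]) auto
    qed
  qed (use below closed in blast)+
qed

section \<open>The nodes of the tree and the size of its levels\<close>

context labelled_clubs
begin

text \<open>
  The function \<open>max i (\<rho>(\<cdot>, \<beta>))\<close> restricted to \<open>\<alpha>\<close>, where a value is represented by the set of its
  upper bounds in \<open>lam\<close>.
\<close>

definition node :: "'b \<Rightarrow> 'a \<Rightarrow> 'a \<Rightarrow> 'a \<rightharpoonup> 'b set" where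
  "node i \<alpha> \<beta> = (\<lambda>\<xi>. if \<xi> \<sqsubset> \<alpha> then Some {j. (i, j) \<in> lam \<and> linked j \<xi> \<beta>} else None)"

definition nodes :: "('a \<rightharpoonup> 'b set) set" where
  "nodes = {node i \<alpha> \<beta> | i \<alpha> \<beta>. i \<in> Field lam \<and> \<beta> \<in> Field \<kappa> \<and> \<alpha> \<sqsubseteq> \<beta>}"

lemma dom_node: "dom (node i \<alpha> \<beta>) = {\<xi>. \<xi> \<sqsubset> \<alpha>}"
  by (auto simp: node_def split: if_splits)

lemma segment_inject: "{\<xi>. \<xi> \<sqsubset> \<alpha>} = {\<xi>. \<xi> \<sqsubset> \<beta>} \<longleftrightarrow> \<alpha> = \<beta>"
  by (metis less_irrefl less_linear mem_Collect_eq)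

lemma node_restrict: "\<alpha>' \<sqsubseteq> \<alpha> \<Longrightarrow> node i \<alpha> \<beta> |` {\<xi>. \<xi> \<sqsubset> \<alpha>'} = node i \<alpha>' \<beta>"
  by (auto simp: node_def restrict_map_def fun_eq_iff dest: less_le_trans)

lemma node_coherent:
  assumes "\<beta> \<in> Field \<kappa>" "linked i \<alpha> \<beta>"
  shows "node i \<alpha> \<alpha> = node i \<alpha> \<beta>"
proof -
  have "(i, j) \<in> lam \<and> linked j \<xi> \<alpha> \<longleftrightarrow> (i, j) \<in> lam \<and> linked j \<xi> \<beta>" if "\<xi> \<sqsubset> \<alpha>" for \<xi> j
    using linked_subadditive[OF assms(1) that] linked_mono[OF assms(2)] by blast
  then show ?thesis
    by (auto simp: node_def fun_eq_iff)
qed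

text \<open>
  Let \<open>\<sigma>\<close> be the last limit point of \<open>C \<beta>\<close> up to \<open>\<alpha>\<close>. Then \<open>C \<beta> \<inter> \<alpha>\<close> is \<open>C \<sigma>\<close> together with a finite
  set, or just a finite set if there is no \<open>\<sigma>\<close>.
\<close>

lemma small_traces:
  assumes \<alpha>: "\<alpha> \<in> Field \<kappa>"
  shows "|(\<lambda>\<beta>. {\<xi> \<in> C \<beta>. \<xi> \<sqsubset> \<alpha>}) ` Field \<kappa>| <o \<kappa>"
proof (rule small_subset)
  let ?P = "({{}} \<union> C ` {\<gamma>. \<gamma> \<sqsubseteq> \<alpha>}) \<times> lists {\<xi>. \<xi> \<sqsubset> \<alpha>}"
  show "|(\<lambda>(A, l). A \<union> set l) ` ?P| <o \<kappa>"
    by (intro small_image small_Times small_Un small_lists small_below small_atMost \<alpha> small_finite) simp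
  show "(\<lambda>\<beta>. {\<xi> \<in> C \<beta>. \<xi> \<sqsubset> \<alpha>}) ` Field \<kappa> \<subseteq> (\<lambda>(A, l). A \<union> set l) ` ?P"
  proof
    fix X assume "X \<in> (\<lambda>\<beta>. {\<xi> \<in> C \<beta>. \<xi> \<sqsubset> \<alpha>}) ` Field \<kappa>"
    then obtain \<beta> where b: "\<beta> \<in> Field \<kappa>" and X: "X = {\<xi> \<in> C \<beta>. \<xi> \<sqsubset> \<alpha>}" by blast
    obtain A where A: "A \<in> {{}} \<union> C ` {\<gamma>. \<gamma> \<sqsubseteq> \<alpha>}" "X = A \<union> last_block X \<alpha>"
    proof (cases "\<exists>\<delta>. limit_point X \<delta> \<and> \<delta> \<sqsubseteq> \<alpha>")
      case True
      then obtain \<delta> where "limit_point X \<delta>" "\<delta> \<sqsubseteq> \<alpha>" by blast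
      from greatest_limit_point[OF this] obtain \<sigma> where s: "limit_point X \<sigma>" "\<sigma> \<sqsubseteq> \<alpha>"
        "\<And>\<delta>. limit_point X \<delta> \<Longrightarrow> \<delta> \<sqsubseteq> \<alpha> \<Longrightarrow> \<delta> \<sqsubseteq> \<sigma>"
        by blast
      have lim: "limit_point (C \<beta>) \<sigma>"
        using s(1) limit_point_mono[of X \<sigma> "C \<beta>"] X by blast
      have "\<sigma> \<sqsubseteq> \<beta>"
      proof (rule ccontr)
        assume "\<not> \<sigma> \<sqsubseteq> \<beta>"
        then obtain a where "a \<in> C \<beta>" "\<beta> \<sqsubset> a"
          using lim by (auto simp: limit_point_def not_le)
        then show False using C_below[OF b] less_asym by blast
      qed
      then consider "\<sigma> \<sqsubset> \<beta>" | "\<sigma> = \<beta>" using le_imp_less_or_eq by blast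
      then have C\<sigma>: "C \<sigma> = {\<xi> \<in> C \<beta>. \<xi> \<sqsubset> \<sigma>}"
        using C_coherent[OF b lim] C_below[OF b] by cases auto
      have "last_block X \<alpha> = {\<xi> \<in> X. \<sigma> \<sqsubseteq> \<xi>}"
        using s order_trans unfolding last_block_def X by blast
      then have "X = C \<sigma> \<union> last_block X \<alpha>"
        unfolding C\<sigma> using s(2) X by (auto simp: not_le intro: less_le_trans)
      with s(2) show thesis by (intro that[of "C \<sigma>"]) auto
    next
      case False
      then have "X = {} \<union> last_block X \<alpha>" using X by (auto simp: last_block_def)
      then show thesis by (intro that[of "{}"]) auto
    qed
    obtain l where l: "set l = last_block X \<alpha>"
      using finite_list[OF finite_last_block] by blast
    then have "l \<in> lists {\<xi>. \<xi> \<sqsubset> \<alpha>}"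
      by (auto simp: last_block_def in_lists_conv_set)
    with A(1) have "(A, l) \<in> ?P" by blast
    with A(2) l show "X \<in> (\<lambda>(A, l). A \<union> set l) ` ?P"
      by (intro image_eqI[of _ _ "(A, l)"]) auto
  qed
qed

text \<open>
  The restriction \<open>F \<beta>\<close> of \<open>\<rho>(\<cdot>, \<beta>)\<close> to \<open>\<alpha>\<close> is obtained from that of \<open>\<rho>(\<cdot>, \<gamma>)\<close>, where \<open>\<gamma> \<ge> \<alpha>\<close> is the first
  step of the walk from \<open>\<beta>\<close> to \<open>\<alpha>\<close>, by an operation \<open>\<Phi>\<close> that depends only on the trace \<open>C \<beta> \<inter> \<alpha>\<close> and
  the label \<open>h \<beta>\<close>. So \<open>F \<beta>\<close> arises from \<open>F \<alpha>\<close> by finitely many such operations, taken from a set of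
  fewer than \<open>\<kappa>\<close>.
\<close>

lemma small_levels:
  assumes \<alpha>: "\<alpha> \<in> Field \<kappa>"
  shows "|{f \<in> nodes. dom f = {\<xi>. \<xi> \<sqsubset> \<alpha>}}| <o \<kappa>"
proof -
  define F where "F = (\<lambda>\<beta> \<xi>. if \<xi> \<sqsubset> \<alpha> then {j. linked j \<xi> \<beta>} else {})"
  define \<Phi> where "\<Phi> = (\<lambda>(A, i) f \<xi>. if \<xi> \<sqsubset> \<alpha> then {j. (i, j) \<in> lam \<and>
     (if \<exists>m\<in>A. \<xi> \<sqsubseteq> m then next_point A \<xi> = \<xi> \<or> linked j \<xi> (next_point A \<xi>) else j \<in> f \<xi>) \<and>
     (\<forall>\<eta>\<in>last_block A \<xi>. linked j \<eta> \<xi>)} else {})"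
  define P where "P = (\<lambda>\<beta>. {\<xi> \<in> C \<beta>. \<xi> \<sqsubset> \<alpha>}) ` Field \<kappa> \<times> Field lam"
  have F_step: "F \<beta> = \<Phi> ({\<xi> \<in> C \<beta>. \<xi> \<sqsubset> \<alpha>}, h \<beta>) (F (next_point (C \<beta>) \<alpha>))"
    if b: "\<beta> \<in> Field \<kappa>" and ab: "\<alpha> \<sqsubset> \<beta>" for \<beta>
  proof
    fix \<xi>
    let ?A = "{\<xi> \<in> C \<beta>. \<xi> \<sqsubset> \<alpha>}"
    note m = next_point_C[OF b ab]
    show "F \<beta> \<xi> = \<Phi> (?A, h \<beta>) (F (next_point (C \<beta>) \<alpha>)) \<xi>"
    proof (cases "\<xi> \<sqsubset> \<alpha>")
      case True
      then have xb: "\<xi> \<sqsubset> \<beta>" using ab less_trans by blast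
      note x = next_point_C[OF b xb]
      have block_eq: "last_block ?A \<xi> = last_block (C \<beta>) \<xi>"
        by (rule last_block_cong) (use True less_trans in blast)
      show ?thesis
      proof (cases "\<exists>m\<in>?A. \<xi> \<sqsubseteq> m")
        case in_A: True
        then have "next_point (C \<beta>) \<xi> \<sqsubset> \<alpha>"
          using x(5) le_less_trans by blast
        then have "next_point ?A \<xi> = next_point (C \<beta>) \<xi>"
          using x by (intro next_point_eqI) auto
        then show ?thesis
          using True in_A xb block_eq unfolding F_def \<Phi>_def by (subst linked_iff) auto
      next
        case False
        then have "\<alpha> \<sqsubseteq> next_point (C \<beta>) \<xi>"
          using x(1,2) by (auto simp: not_less[symmetric])
        then have "next_point (C \<beta>) \<xi> = next_point (C \<beta>) \<alpha>"
          using x m True by (intro order.antisym x(5) m(5)) (auto intro: less_imp_le less_le_trans)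
        moreover have "next_point (C \<beta>) \<alpha> \<noteq> \<xi>"
          using m(2) True by auto
        ultimately show ?thesis
          using True False xb block_eq unfolding F_def \<Phi>_def by (subst linked_iff) auto
      qed
    qed (simp add: F_def \<Phi>_def)
  qed
  have F_gen: "\<alpha> \<sqsubseteq> \<beta> \<Longrightarrow> \<beta> \<in> Field \<kappa> \<Longrightarrow> F \<beta> \<in> (\<lambda>l. foldr \<Phi> l (F \<alpha>)) ` lists P" for \<beta>
  proof (induction \<beta> rule: less_induct)
    case (less \<beta>)
    show ?case
    proof (cases "\<alpha> = \<beta>")
      case True
      then have "F \<beta> = foldr \<Phi> [] (F \<alpha>)" by simp
      then show ?thesis by blast
    next
      case False
      then have ab: "\<alpha> \<sqsubset> \<beta>" using less.prems by simp
      note m = next_point_C[OF less.prems(2) ab]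
      obtain l where "l \<in> lists P" "F (next_point (C \<beta>) \<alpha>) = foldr \<Phi> l (F \<alpha>)"
        using less.IH[OF m(3,2,4)] by blast
      moreover have "({\<xi> \<in> C \<beta>. \<xi> \<sqsubset> \<alpha>}, h \<beta>) \<in> P"
        using less.prems h_Field by (auto simp: P_def)
      ultimately show ?thesis
        using F_step[OF less.prems(2) ab]
        by (intro image_eqI[of _ _ "({\<xi> \<in> C \<beta>. \<xi> \<sqsubset> \<alpha>}, h \<beta>) # l"]) auto
    qed
  qed
  have lam_small: "|Field lam| <o \<kappa>"
    using lam by (auto intro: ordIso_ordLess_trans[OF card_of_Field_ordIso])
  have "|P| <o \<kappa>"
    unfolding P_def by (intro small_Times small_traces \<alpha> lam_small)
  then have small: "|(\<lambda>(i, f) \<xi>. if \<xi> \<sqsubset> \<alpha> then Some {j \<in> f \<xi>. (i, j) \<in> lam} else None) `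
      (Field lam \<times> (\<lambda>l. foldr \<Phi> l (F \<alpha>)) ` lists P)| <o \<kappa>"
    by (intro small_image small_Times small_lists lam_small)
  show ?thesis
  proof (rule small_subset[OF small], rule subsetI)
    fix f assume "f \<in> {f \<in> nodes. dom f = {\<xi>. \<xi> \<sqsubset> \<alpha>}}"
    then obtain i \<beta> where f: "f = node i \<alpha> \<beta>" "i \<in> Field lam" "\<beta> \<in> Field \<kappa>" "\<alpha> \<sqsubseteq> \<beta>"
      by (auto simp: nodes_def dom_node segment_inject)
    have "f = (\<lambda>\<xi>. if \<xi> \<sqsubset> \<alpha> then Some {j \<in> F \<beta> \<xi>. (i, j) \<in> lam} else None)"
      unfolding f(1) node_def F_def by (auto simp: fun_eq_iff)
    then show "f \<in> (\<lambda>(i, f) \<xi>. if \<xi> \<sqsubset> \<alpha> then Some {j \<in> f \<xi>. (i, j) \<in> lam} else None) `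
      (Field lam \<times> (\<lambda>l. foldr \<Phi> l (F \<alpha>)) ` lists P)"
      using f(2) F_gen[OF f(4,3)] by (intro image_eqI[of _ _ "(i, F \<beta>)"]) auto
  qed
qed

lemma card_nodes: "|nodes| \<le>o \<kappa>"
proof -
  have "nodes \<subseteq> (\<lambda>(i, \<alpha>, \<beta>). node i \<alpha> \<beta>) ` (Field lam \<times> Field \<kappa> \<times> Field \<kappa>)"
    using Field_down unfolding nodes_def by force
  then have "|nodes| \<le>o |Field lam \<times> Field \<kappa> \<times> Field \<kappa>|"
    by (rule ordLeq_transitive[OF card_of_mono1 card_of_image])
  moreover have "|Field lam| \<le>o \<kappa>" "|Field \<kappa>| \<le>o \<kappa>"
    using lam Card_order
    by (auto intro: ordIso_ordLeq_trans[OF card_of_Field_ordIso] ordLess_imp_ordLeq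
        ordIso_imp_ordLeq[OF card_of_Field_ordIso])
  then have "|Field lam \<times> Field \<kappa> \<times> Field \<kappa>| \<le>o \<kappa>"
    by (intro card_of_Times_ordLeq_infinite_Field infinite_Field Card_order)
  ultimately show ?thesis
    by (rule ordLeq_transitive)
qed

end

section \<open>Trees of partial functions\<close>

text \<open>
  Partial functions ordered by extension; the injection \<open>g\<close> renames the nodes, so that the tree can
  live on a prescribed type.
\<close>

definition map_tree :: "(('a \<rightharpoonup> 'c) \<Rightarrow> 't) \<Rightarrow> ('a \<rightharpoonup> 'c) set \<Rightarrow> 't rel" where
  "map_tree g F = {(g f, g f') | f f'. f \<in> F \<and> f' \<in> F \<and> f \<subseteq>\<^sub>m f'}"

context regular_uncountable
begin

text \<open>
  The predecessors of \<open>f\<close> are its restrictions to the proper initial segments of its domain \<open>\<alpha>\<close>, so they form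
  a copy of \<open>\<alpha>\<close>. Heights therefore are domains, as distinct ordinals are not isomorphic.
\<close>

lemma map_tree_levels:
  fixes F :: "('a \<rightharpoonup> 'c) set" and g :: "('a \<rightharpoonup> 'c) \<Rightarrow> 't"
  assumes g: "inj_on g F"
    and dom: "\<And>f. f \<in> F \<Longrightarrow> \<exists>\<alpha>\<in>Field \<kappa>. dom f = {\<xi>. \<xi> \<sqsubset> \<alpha>}"
    and restrict: "\<And>f \<alpha>. f \<in> F \<Longrightarrow> {\<xi>. \<xi> \<sqsubset> \<alpha>} \<subseteq> dom f \<Longrightarrow> f |` {\<xi>. \<xi> \<sqsubset> \<alpha>} \<in> F"
  shows "tree (map_tree g F)"
    and "nodes_of_height (map_tree g F) \<kappa> = {}"
    and "\<And>\<alpha>. \<alpha> \<in> Field \<kappa> \<Longrightarrow> level \<kappa> (map_tree g F) \<alpha> = g ` {f \<in> F. dom f = {\<xi>. \<xi> \<sqsubset> \<alpha>}}"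
proof -
  let ?T = "map_tree g F"
  have WO: "Well_order \<kappa>" using Card_order by (auto simp: card_order_on_def)
  then interpret W: wo_rel \<kappa> by (simp add: wo_rel_def)
  have T_iff: "(g f, g f') \<in> ?T \<longleftrightarrow> f \<subseteq>\<^sub>m f'" if "f \<in> F" "f' \<in> F" for f f'
    using that inj_onD[OF g] unfolding map_tree_def by blast
  have T_F: "\<exists>f\<in>F. \<exists>f'\<in>F. t = g f \<and> t' = g f' \<and> f \<subseteq>\<^sub>m f'" if "(t, t') \<in> ?T" for t t'
    using that unfolding map_tree_def by blast
  have Field_T: "Field ?T = g ` F"
  proof
    show "Field ?T \<subseteq> g ` F" using T_F unfolding Field_def by blast
    show "g ` F \<subseteq> Field ?T" using T_iff map_le_refl by (blast intro: FieldI1)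
  qed
  have "Partial_order ?T"
    unfolding partial_order_on_def preorder_on_def
  proof (intro conjI)
    show "?T \<subseteq> Field ?T \<times> Field ?T" by (auto simp: Field_def)
    show "refl_on (Field ?T) ?T"
      unfolding refl_on_def Field_T using T_iff by auto
    show "trans ?T"
      unfolding trans_def using T_F T_iff map_le_trans by (metis)
    show "antisym ?T"
      unfolding antisym_def using T_F T_iff map_le_antisym by (metis)
  qed
  have height: "Restr \<kappa> (underS \<kappa> \<alpha>) =o Restr ?T (underS ?T (g f))
      \<and> Field (Restr ?T (underS ?T (g f))) = underS ?T (g f)"
    if f: "f \<in> F" and a: "\<alpha> \<in> Field \<kappa>" and d: "dom f = {\<xi>. \<xi> \<sqsubset> \<alpha>}" for f \<alpha>
  proof -
    define k where "k = (\<lambda>\<beta>. g (f |` {\<xi>. \<xi> \<sqsubset> \<beta>}))"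
    have rF: "f |` {\<xi>. \<xi> \<sqsubset> \<beta>} \<in> F" if "\<beta> \<sqsubset> \<alpha>" for \<beta>
      by (rule restrict[OF f]) (use d that less_trans in auto)
    have dr: "dom (f |` {\<xi>. \<xi> \<sqsubset> \<beta>}) = {\<xi>. \<xi> \<sqsubset> \<beta>}" if "\<beta> \<sqsubset> \<alpha>" for \<beta>
      using d that less_trans by auto
    have le: "f |` {\<xi>. \<xi> \<sqsubset> \<beta>} \<subseteq>\<^sub>m f |` {\<xi>. \<xi> \<sqsubset> \<gamma>} \<longleftrightarrow> \<beta> \<sqsubseteq> \<gamma>" if "\<beta> \<sqsubset> \<alpha>" "\<gamma> \<sqsubset> \<alpha>" for \<beta> \<gamma>
    proof
      assume "f |` {\<xi>. \<xi> \<sqsubset> \<beta>} \<subseteq>\<^sub>m f |` {\<xi>. \<xi> \<sqsubset> \<gamma>}"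
      then have "{\<xi>. \<xi> \<sqsubset> \<beta>} \<subseteq> {\<xi>. \<xi> \<sqsubset> \<gamma>}"
        using map_le_implies_dom_le dr that by metis
      then show "\<beta> \<sqsubseteq> \<gamma>" using not_less by blast
    next
      assume "\<beta> \<sqsubseteq> \<gamma>"
      then show "f |` {\<xi>. \<xi> \<sqsubset> \<beta>} \<subseteq>\<^sub>m f |` {\<xi>. \<xi> \<sqsubset> \<gamma>}"
        by (auto simp: map_le_def restrict_map_def dest: less_le_trans)
    qed
    have kT: "(k \<beta>, k \<gamma>) \<in> ?T \<longleftrightarrow> \<beta> \<sqsubseteq> \<gamma>" if "\<beta> \<sqsubset> \<alpha>" "\<gamma> \<sqsubset> \<alpha>" for \<beta> \<gamma>
      unfolding k_def using T_iff[OF rF rF] le that by simp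
    have k_inj: "inj_on k {\<beta>. \<beta> \<sqsubset> \<alpha>}"
      using kT by (intro inj_onI) (metis order.antisym mem_Collect_eq order_refl)
    have U: "underS ?T (g f) = k ` {\<beta>. \<beta> \<sqsubset> \<alpha>}"
    proof (intro set_eqI iffI)
      fix t assume "t \<in> underS ?T (g f)"
      then have t: "t \<noteq> g f" "(t, g f) \<in> ?T" by (auto simp: underS_def)
      then obtain f' where f': "f' \<in> F" "t = g f'" using T_F by blast
      have le': "f' \<subseteq>\<^sub>m f" using T_iff[OF f'(1) f] t f' by simp
      obtain \<beta> where b: "dom f' = {\<xi>. \<xi> \<sqsubset> \<beta>}" using dom[OF f'(1)] by blast
      have res: "f' = f |` {\<xi>. \<xi> \<sqsubset> \<beta>}"
        using le' b by (fastforce simp: map_le_def restrict_map_def fun_eq_iff)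
      have "\<beta> \<sqsubset> \<alpha>"
      proof (rule ccontr)
        assume "\<not> \<beta> \<sqsubset> \<alpha>"
        then have "dom f \<subseteq> {\<xi>. \<xi> \<sqsubset> \<beta>}" using d by (auto simp: not_less dest: less_le_trans)
        then have "f x = None" if "\<not> x \<sqsubset> \<beta>" for x
          using that by (meson domIff mem_Collect_eq subsetD)
        then have "f' = f"
          unfolding res restrict_map_def by (intro ext) simp
        with t f' show False by blast
      qed
      then show "t \<in> k ` {\<beta>. \<beta> \<sqsubset> \<alpha>}" using res f' by (auto simp: k_def)
    next
      fix t assume "t \<in> k ` {\<beta>. \<beta> \<sqsubset> \<alpha>}"
      then obtain \<beta> where b: "\<beta> \<sqsubset> \<alpha>" "t = k \<beta>" by blast
      have "f |` {\<xi>. \<xi> \<sqsubset> \<beta>} \<subseteq>\<^sub>m f" by (auto simp: map_le_def)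
      then have "(t, g f) \<in> ?T" using T_iff[OF rF[OF b(1)] f] b by (simp add: k_def)
      moreover have "t \<noteq> g f"
      proof
        assume "t = g f"
        then have "f |` {\<xi>. \<xi> \<sqsubset> \<beta>} = f" using inj_onD[OF g] rF[OF b(1)] f b(2) by (simp add: k_def)
        then show False using dr[OF b(1)] d b(1) by auto
      qed
      ultimately show "t \<in> underS ?T (g f)" by (simp add: underS_def)
    qed
    have R_iff: "(x, y) \<in> Restr \<kappa> (underS \<kappa> \<alpha>) \<longleftrightarrow> x \<sqsubset> \<alpha> \<and> y \<sqsubset> \<alpha> \<and> x \<sqsubseteq> y" for x y
      using underS_eq[OF a] initial_segment Field_down'[OF a] by auto
    have dir: "Restr ?T (underS ?T (g f)) = dir_image (Restr \<kappa> (underS \<kappa> \<alpha>)) k"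
      (is "?R = ?D")
    proof (intro set_eqI iffI; clarify)
      fix t t' assume "(t, t') \<in> ?T" "t \<in> underS ?T (g f)" "t' \<in> underS ?T (g f)"
      then obtain \<beta> \<gamma> where "t = k \<beta>" "t' = k \<gamma>" "\<beta> \<sqsubset> \<alpha>" "\<gamma> \<sqsubset> \<alpha>" "\<beta> \<sqsubseteq> \<gamma>"
        unfolding U using kT by blast
      then show "(t, t') \<in> ?D"
        using R_iff unfolding dir_image_def by blast
    next
      fix t t' assume "(t, t') \<in> ?D"
      then obtain \<beta> \<gamma> where "t = k \<beta>" "t' = k \<gamma>" "\<beta> \<sqsubset> \<alpha>" "\<gamma> \<sqsubset> \<alpha>" "\<beta> \<sqsubseteq> \<gamma>"
        unfolding dir_image_def using R_iff by blast
      then show "(t, t') \<in> ?R"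
        unfolding U using kT by blast
    qed
    have FR: "Field (Restr \<kappa> (underS \<kappa> \<alpha>)) = {\<beta>. \<beta> \<sqsubset> \<alpha>}"
      using R_iff unfolding Field_def by auto
    have wR: "Well_order (Restr \<kappa> (underS \<kappa> \<alpha>))"
      by (rule Well_order_Restr[OF WO])
    show ?thesis
      unfolding dir using dir_image_ordIso[OF wR, of k] k_inj
        dir_image_Field[of "Restr \<kappa> (underS \<kappa> \<alpha>)" k] by (simp add: FR U)
  qed
  show "tree ?T"
    unfolding tree_def
  proof (intro conjI ballI)
    fix t assume "t \<in> Field ?T"
    then obtain f where f: "f \<in> F" "t = g f" using Field_T by blast
    obtain \<alpha> where "\<alpha> \<in> Field \<kappa>" "dom f = {\<xi>. \<xi> \<sqsubset> \<alpha>}" using dom[OF f(1)] by blast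
    from height[OF f(1) this] show "well_order_on (underS ?T t) (Restr ?T (underS ?T t))"
      using f(2) by (auto simp: ordIso_def)
  qed fact
  show "nodes_of_height ?T \<kappa> = {}"
  proof -
    have False if f: "f \<in> F" and iso: "Restr ?T (underS ?T (g f)) =o \<kappa>" for f
    proof -
      obtain \<alpha> where a: "\<alpha> \<in> Field \<kappa>" "dom f = {\<xi>. \<xi> \<sqsubset> \<alpha>}" using dom[OF f] by blast
      have "Restr \<kappa> (underS \<kappa> \<alpha>) =o \<kappa>"
        using height[OF f a] iso ordIso_transitive by blast
      moreover have "Restr \<kappa> (underS \<kappa> \<alpha>) <o \<kappa>"
        using underS_Restr_ordLess[OF WO] a(1) by blast
      ultimately show False
        using not_ordLess_ordIso by blast
    qed
    then show ?thesis
      unfolding nodes_of_height_def Field_T by blast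
  qed
  have seg_less: "Restr \<kappa> (underS \<kappa> \<alpha>) <o Restr \<kappa> (underS \<kappa> \<beta>)"
    if "\<alpha> \<sqsubset> \<beta>" "\<beta> \<in> Field \<kappa>" for \<alpha> \<beta>
  proof -
    have "underS \<kappa> \<alpha> \<subset> underS \<kappa> \<beta>"
      using underS_eq[OF that(2)] underS_eq[OF Field_down'[OF that(2,1)]] that less_trans by auto
    then show ?thesis
      using ofilter_subset_ordLess[OF WO W.underS_ofilter W.underS_ofilter] by blast
  qed
  show "level \<kappa> ?T \<alpha> = g ` {f \<in> F. dom f = {\<xi>. \<xi> \<sqsubset> \<alpha>}}" if a: "\<alpha> \<in> Field \<kappa>" for \<alpha>
  proof -
    have "Restr ?T (underS ?T (g f)) =o Restr \<kappa> (underS \<kappa> \<alpha>) \<longleftrightarrow> dom f = {\<xi>. \<xi> \<sqsubset> \<alpha>}"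
      if f: "f \<in> F" for f
    proof
      assume iso: "Restr ?T (underS ?T (g f)) =o Restr \<kappa> (underS \<kappa> \<alpha>)"
      obtain \<beta> where b: "\<beta> \<in> Field \<kappa>" "dom f = {\<xi>. \<xi> \<sqsubset> \<beta>}" using dom[OF f] by blast
      have eq: "Restr \<kappa> (underS \<kappa> \<beta>) =o Restr \<kappa> (underS \<kappa> \<alpha>)"
        using height[OF f b] iso ordIso_transitive by blast
      have "\<not> \<beta> \<sqsubset> \<alpha>" using eq seg_less[OF _ a] not_ordLess_ordIso by blast
      moreover have "\<not> \<alpha> \<sqsubset> \<beta>" using ordIso_symmetric[OF eq] seg_less[OF _ b(1)] not_ordLess_ordIso by blast
      ultimately have "\<beta> = \<alpha>" using less_linear by blast
      then show "dom f = {\<xi>. \<xi> \<sqsubset> \<alpha>}" using b(2) by simp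
    next
      assume "dom f = {\<xi>. \<xi> \<sqsubset> \<alpha>}"
      then show "Restr ?T (underS ?T (g f)) =o Restr \<kappa> (underS \<kappa> \<alpha>)"
        using height[OF f a] ordIso_symmetric by blast
    qed
    then show ?thesis
      unfolding level_def nodes_of_height_def Field_T by blast
  qed
qed

end

section \<open>The Aronszajn tree and its ascent path\<close>

context labelled_clubs
begin

text \<open>
  Along a cofinal branch, choose for each \<open>\<xi>\<close> a bound \<open>j \<xi>\<close> of the value at \<open>\<xi>\<close>. One bound \<open>k\<close> serves
  unboundedly many \<open>\<xi>\<close>, and any two of these are linked at \<open>k\<close>, because some node on the branch has
  both in its domain. This contradicts \<open>no_unbounded_linked\<close>.
\<close>

lemma aronszajn_tree_with_ascent_path:
  "\<exists>T :: 'a rel. aronszajn_tree \<kappa> T \<and> (\<exists>b. ascent_path lam \<kappa> T b)"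
proof -
  have "|nodes| \<le>o |Field \<kappa>|"
    using ordLeq_ordIso_trans[OF card_nodes ordIso_symmetric[OF card_of_Field_ordIso[OF Card_order]]] .
  then obtain g :: "('a \<rightharpoonup> 'b set) \<Rightarrow> 'a" where g: "inj_on g nodes"
    using card_of_ordLeq[of nodes "Field \<kappa>"] by auto
  define T where "T = map_tree g nodes"
  have node_in: "node i \<alpha> \<beta> \<in> nodes" if "i \<in> Field lam" "\<beta> \<in> Field \<kappa>" "\<alpha> \<sqsubseteq> \<beta>" for i \<alpha> \<beta>
    using that by (auto simp: nodes_def)
  have nodes_dom: "\<exists>\<alpha>\<in>Field \<kappa>. dom f = {\<xi>. \<xi> \<sqsubset> \<alpha>}" if "f \<in> nodes" for f
    using that Field_down dom_node unfolding nodes_def by blast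
  have nodes_restrict: "f |` {\<xi>. \<xi> \<sqsubset> \<alpha>} \<in> nodes"
    if F: "f \<in> nodes" "{\<xi>. \<xi> \<sqsubset> \<alpha>} \<subseteq> dom f" for f \<alpha>
  proof -
    obtain i \<gamma> \<beta> where f: "f = node i \<gamma> \<beta>" "i \<in> Field lam" "\<beta> \<in> Field \<kappa>" "\<gamma> \<sqsubseteq> \<beta>"
      using F(1) by (auto simp: nodes_def)
    have "\<alpha> \<sqsubseteq> \<gamma>"
      using F(2) unfolding f(1) dom_node using not_less by blast
    then show ?thesis
      using f node_restrict[of \<alpha> \<gamma> i \<beta>] node_in[of i \<beta> \<alpha>] order_trans by metis
  qed
  have T: "tree T" "nodes_of_height T \<kappa> = {}"
    "\<And>\<alpha>. \<alpha> \<in> Field \<kappa> \<Longrightarrow> level \<kappa> T \<alpha> = g ` {f \<in> nodes. dom f = {\<xi>. \<xi> \<sqsubset> \<alpha>}}"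
    unfolding T_def by (rule map_tree_levels[OF g]; use nodes_dom nodes_restrict in blast)+
  have T_iff: "(g f, g f') \<in> T \<longleftrightarrow> f \<subseteq>\<^sub>m f'" if "f \<in> nodes" "f' \<in> nodes" for f f'
    using that inj_onD[OF g] unfolding T_def map_tree_def by blast
  have node_level: "g (node i \<alpha> \<alpha>) \<in> level \<kappa> T \<alpha>" if "i \<in> Field lam" "\<alpha> \<in> Field \<kappa>" for i \<alpha>
    using T(3)[OF that(2)] node_in[OF that order_refl] by (auto simp: dom_node)
  obtain i0 where i0: "i0 \<in> Field lam"
    using lam(1) by (metis cinfinite_def ex_in_conv finite.emptyI)
  have lam_small: "|Field lam| <o \<kappa>"
    using lam by (auto intro: ordIso_ordLess_trans[OF card_of_Field_ordIso])
  have "kappa_tree \<kappa> T"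
    unfolding kappa_tree_def has_height_def
  proof (intro conjI ballI)
    fix \<alpha> assume a: "\<alpha> \<in> Field \<kappa>"
    show "level \<kappa> T \<alpha> \<noteq> {}" using node_level[OF i0 a] by blast
    show "|level \<kappa> T \<alpha>| <o \<kappa>"
      unfolding T(3)[OF a] by (intro small_image small_levels a)
  qed (fact T)+
  moreover have "\<not> cofinal_branch \<kappa> T B" for B
  proof
    assume B: "cofinal_branch \<kappa> T B"
    have "\<exists>f j. f \<in> nodes \<and> g f \<in> B \<and> \<xi> \<in> dom f \<and> j \<in> Field lam \<and> j \<in> the (f \<xi>)"
      if xi: "\<xi> \<in> Field \<kappa>" for \<xi>
    proof -
      obtain \<zeta> where z: "\<zeta> \<in> Field \<kappa>" "\<xi> \<sqsubset> \<zeta>" using no_maximum[OF xi] by blast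
      then obtain \<alpha> t where a: "\<alpha> \<in> Field \<kappa>" "(\<zeta>, \<alpha>) \<in> \<kappa>" "t \<in> B" "t \<in> level \<kappa> T \<alpha>"
        using B unfolding cofinal_branch_def by blast
      then obtain f where f: "f \<in> nodes" "t = g f" "dom f = {\<xi>. \<xi> \<sqsubset> \<alpha>}"
        using T(3) by blast
      have "\<xi> \<sqsubset> \<alpha>" using z a initial_segment less_le_trans by blast
      obtain i \<beta> where n: "f = node i \<alpha> \<beta>" "i \<in> Field lam" "\<beta> \<in> Field \<kappa>" "\<alpha> \<sqsubseteq> \<beta>"
        using f by (auto simp: nodes_def dom_node segment_inject)
      obtain j0 where j0: "j0 \<in> Field lam" "linked j0 \<xi> \<beta>"
        using eventually_linked n(3,4) \<open>\<xi> \<sqsubset> \<alpha>\<close> less_le_trans by blast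
      obtain j where j: "j \<in> Field lam" "(i, j) \<in> lam" "(j0, j) \<in> lam"
        using lam_directed[of "{i, j0}"] n(2) j0(1) by auto
      then have "j \<in> the (f \<xi>)"
        using linked_mono j0(2) \<open>\<xi> \<sqsubset> \<alpha>\<close> by (auto simp: n(1) node_def)
      then show ?thesis
        using f a(3) j(1) \<open>\<xi> \<sqsubset> \<alpha>\<close> by blast
    qed
    then obtain f j where fj: "\<And>\<xi>. \<xi> \<in> Field \<kappa> \<Longrightarrow> f \<xi> \<in> nodes \<and> g (f \<xi>) \<in> B \<and> \<xi> \<in> dom (f \<xi>)
        \<and> j \<xi> \<in> Field lam \<and> j \<xi> \<in> the (f \<xi> \<xi>)"
      by metis
    have "\<exists>k\<in>Field lam. unbounded {\<xi> \<in> Field \<kappa>. j \<xi> = k}"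
    proof (rule ccontr)
      assume no: "\<not> ?thesis"
      have "|{\<xi> \<in> Field \<kappa>. j \<xi> = k}| <o \<kappa>" if k: "k \<in> Field lam" for k
      proof -
        have "\<not> unbounded {\<xi> \<in> Field \<kappa>. j \<xi> = k}"
          using no k by blast
        then obtain \<zeta> where "\<zeta> \<in> Field \<kappa>" "\<forall>\<xi>\<in>{\<xi> \<in> Field \<kappa>. j \<xi> = k}. \<not> \<zeta> \<sqsubset> \<xi>"
          unfolding unbounded_def by blast
        then show ?thesis
          by (intro small_subset[OF small_atMost[of \<zeta>]]) (auto simp: not_less)
      qed
      then have "|\<Union>k\<in>Field lam. {\<xi> \<in> Field \<kappa>. j \<xi> = k}| <o \<kappa>"
        by (rule small_Union[OF lam_small])
      then have "|Field \<kappa>| <o \<kappa>"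
        by (rule small_subset) (use fj in blast)
      then show False
        using card_of_Field_ordIso[OF Card_order] not_ordLess_ordIso by blast
    qed
    then obtain k where k: "k \<in> Field lam" "unbounded {\<xi> \<in> Field \<kappa>. j \<xi> = k}" by blast
    obtain \<alpha> \<beta> where ab: "\<alpha> \<in> Field \<kappa>" "j \<alpha> = k" "\<beta> \<in> Field \<kappa>" "j \<beta> = k" "\<alpha> \<sqsubset> \<beta>"
      and not_linked: "\<not> linked k \<alpha> \<beta>"
      using no_unbounded_linked[OF k] by blast
    have "(g (f \<alpha>), g (f \<beta>)) \<in> T \<or> (g (f \<beta>), g (f \<alpha>)) \<in> T"
      using B fj[OF ab(1)] fj[OF ab(3)] by (auto simp: cofinal_branch_def Chains_def)
    then have "f \<alpha> \<subseteq>\<^sub>m f \<beta> \<or> f \<beta> \<subseteq>\<^sub>m f \<alpha>"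
      using T_iff fj[OF ab(1)] fj[OF ab(3)] by blast
    then obtain \<phi> where phi: "\<phi> \<in> nodes" "f \<alpha> \<subseteq>\<^sub>m \<phi>" "f \<beta> \<subseteq>\<^sub>m \<phi>"
      using fj[OF ab(1)] fj[OF ab(3)] map_le_refl[of "f \<alpha>"] map_le_refl[of "f \<beta>"] by blast
    then have "f \<alpha> \<alpha> = \<phi> \<alpha>" "f \<beta> \<beta> = \<phi> \<beta>"
      using fj[OF ab(1)] fj[OF ab(3)] unfolding map_le_def by blast+
    then have "\<phi> \<alpha> = f \<alpha> \<alpha>" "\<phi> \<beta> = f \<beta> \<beta>"
      by simp_all
    then have "\<alpha> \<in> dom \<phi>" "\<beta> \<in> dom \<phi>" "k \<in> the (\<phi> \<alpha>)" "k \<in> the (\<phi> \<beta>)"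
      using fj[OF ab(1)] fj[OF ab(3)] ab by auto
    moreover obtain i \<gamma> \<delta> where "\<phi> = node i \<gamma> \<delta>" "\<delta> \<in> Field \<kappa>"
      using phi(1) by (auto simp: nodes_def)
    ultimately have "\<delta> \<in> Field \<kappa>" "linked k \<alpha> \<delta>" "linked k \<beta> \<delta>"
      by (auto simp: node_def split: if_splits)
    then show False
      using linked_subadditive ab(5) not_linked by blast
  qed
  moreover have "ascent_path lam \<kappa> T (\<lambda>\<alpha> i. g (node i \<alpha> \<alpha>))"
    unfolding ascent_path_def
  proof (intro conjI ballI)
    fix \<alpha> \<beta> assume b: "\<beta> \<in> Field \<kappa>" and a: "\<alpha> \<in> underS \<kappa> \<beta>"
    have ab: "\<alpha> \<sqsubset> \<beta>" using a underS_eq[OF b] by blast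
    obtain i where i: "i \<in> Field lam" "linked i \<alpha> \<beta>"
      using eventually_linked[OF b ab] by blast
    have "g (node j \<alpha> \<alpha>) \<in> underS T (g (node j \<beta> \<beta>))" if j: "j \<in> Field lam" "(i, j) \<in> lam" for j
    proof -
      have nodes: "node j \<alpha> \<alpha> \<in> nodes" "node j \<beta> \<beta> \<in> nodes"
        using node_in j(1) b Field_down'[OF b ab] by auto
      have "node j \<alpha> \<alpha> = node j \<alpha> \<beta>"
        by (rule node_coherent[OF b linked_mono[OF i(2) j(2)]])
      also have "\<dots> = node j \<beta> \<beta> |` {\<xi>. \<xi> \<sqsubset> \<alpha>}"
        using node_restrict[of \<alpha> \<beta> j \<beta>] ab by simp
      finally have "node j \<alpha> \<alpha> \<subseteq>\<^sub>m node j \<beta> \<beta>"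
        by (auto simp: map_le_def)
      moreover have "node j \<alpha> \<alpha> \<noteq> node j \<beta> \<beta>"
        using dom_node segment_inject ab by (metis less_irrefl)
      ultimately show ?thesis
        using T_iff[OF nodes] inj_onD[OF g _ nodes] by (auto simp: underS_def)
    qed
    with i(1) show "\<exists>i\<in>Field lam. \<forall>j\<in>Field lam. (i, j) \<in> lam \<longrightarrow>
        g (node j \<alpha> \<alpha>) \<in> underS T (g (node j \<beta> \<beta>))"
      by blast
  qed (rule node_level)
  ultimately show ?thesis
    unfolding aronszajn_tree_def by blast
qed

end

theorem theorem1p1:
  fixes \<kappa> :: "'a rel" and lam :: "'b rel"
  assumes "Cinfinite lam" and "regularCard lam"
    and "Cinfinite \<kappa>" and "regularCard \<kappa>"
    and "lam <o \<kappa>"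
    and "square \<kappa>"
  shows "\<exists>T :: 'a rel. aronszajn_tree \<kappa> T \<and> (\<exists>b. ascent_path lam \<kappa> T b)"
proof -
  have "Well_order \<kappa>"
    using assms(3) by (auto simp: card_order_on_def)
  then obtain le lt where wo: "class.wellorder le lt"
    and le: "\<And>x y. y \<in> Field \<kappa> \<Longrightarrow> le x y \<longleftrightarrow> (x, y) \<in> \<kappa>"
    using wellorder_extending_Well_order by blast
  have "natLeq \<le>o lam"
    using assms(1) natLeq_ordLeq_cinfinite by blast
  then have "natLeq <o \<kappa>"
    using assms(5) by (rule ordLeq_ordLess_trans)
  then have ru: "regular_uncountable le lt \<kappa>"
    using wo le assms(3,4) by (simp add: regular_uncountable_def regular_uncountable_axioms_def)
  obtain C where "square_seq \<kappa> C"
    using assms(6) by (auto simp: square_def)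
  then interpret square_sequence le lt \<kappa> C
    using ru by (intro square_seq_imp_square_sequence)
  obtain C' h where "labelled_clubs le lt \<kappa> lam C' h"
    using ex_labelled_clubs[OF assms(1,5)] by blast
  then show ?thesis
    by (rule labelled_clubs.aronszajn_tree_with_ascent_path)
qed

end
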